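(* Let $p$ be a prime and let $G=C_{p^{n_1}}\times\cdots\times C_{p^{n_r}}$ (with all $n_i\ge 1$) be a finite abelian $p$-group with corresponding generators $g_1,\dots,g_r$ ($g_i$ of order $p^{n_i}$), and suppose $|G|>2$. Let $\widetilde{G}=\sum_{g\in G}g$ and set $x_i=g_i-1\in\mathbb{F}_p[G]$. Then $K_2(\mathbb{F}_p[G],(\widetilde{G}))$ is an elementary abelian $p$-group of rank $r$ with basis $$\left\{\left\langle x_i,\ \prod_{j=1}^{r}x_j^{p^{n_j}-1}\right\rangle\ \middle|\ 1\le i\le r\right\}.$$
   Context: $(\widetilde{G})$ denotes the ideal of $\mathbb{F}_p[G]$ generated by $\widetilde{G}$. In $\mathbb{F}_p[G]$ one has $\widetilde{G}=\prod_{j=1}^r x_j^{p^{n_j}-1}$, so the symbols in the statement are defined. For a commutative ring $R$ and a radical ideal $\mathfrak{a}$ of $R$ (an ideal contained in the Jacobson radical, e.g. one with $\mathfrak{a}^2=0$), the relative group $K_2(R,\mathfrak{a})$ is the abelian group generated by the Dennis–Stein symbols $\langle a,b\rangle$ with $(a,b)\in(R\times\mathfrak{a})\cup(\mathfrak{a}\times R)$, subject to the relations (written multiplicatively, whenever all the symbols involved are defined): (DS1) $\langle a,b\rangle\langle b,a\rangle=1$; (DS2) $\langle a,b\rangle\langle a,c\rangle=\langle a,b+c-abc\rangle$; (DS3) $\langle a,bc\rangle=\langle ab,c\rangle\langle ac,b\rangle$ where at least one of $a,b,c$ lies in $\mathfrak{a}$. A basis of an elementary abelian $p$-group means a basis as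 an $\mathbb{F}_p$-vector space. *)

theory Defs
  imports
    "HOL-Algebra.Free_Abelian_Groups"
    "HOL-Number_Theory.Residues"
    "Jordan_Normal_Form.Missing_VectorSpace"
begin

section \<open>Group rings\<close>

text \<open>
  The group ring $R[G]$: finitely supported functions from $G$ to $R$ with the convolution
  product $(f h)(x) = \sum_y f(y)\, h(y^{-1} x)$. The sum is taken over the support of $f$ because
  \<^const>\<open>finsum\<close> over an infinite index set is zero.
\<close>

definition group_ring ::
    "('r, 'm) ring_scheme \<Rightarrow> ('g, 'n) monoid_scheme \<Rightarrow> ('g \<Rightarrow> 'r) ring" where
  "group_ring R G =
    \<lparr>carrier = {f \<in> carrier G \<rightarrow>\<^sub>E carrier R. finite {x \<in> carrier G. f x \<noteq> \<zero>\<^bsub>R\<^esub>}},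
     monoid.mult = (\<lambda>f h. \<lambda>x\<in>carrier G.
       \<Oplus>\<^bsub>R\<^esub>y\<in>{y \<in> carrier G. f y \<noteq> \<zero>\<^bsub>R\<^esub>}. f y \<otimes>\<^bsub>R\<^esub> h (inv\<^bsub>G\<^esub> y \<otimes>\<^bsub>G\<^esub> x)),
     monoid.one = (\<lambda>x\<in>carrier G. if x = \<one>\<^bsub>G\<^esub> then \<one>\<^bsub>R\<^esub> else \<zero>\<^bsub>R\<^esub>),
     ring.zero = (\<lambda>x\<in>carrier G. \<zero>\<^bsub>R\<^esub>),
     ring.add = (\<lambda>f h. \<lambda>x\<in>carrier G. f x \<oplus>\<^bsub>R\<^esub> h x)\<rparr>"

definition group_ring_of ::
    "('r, 'm) ring_scheme \<Rightarrow> ('g, 'n) monoid_scheme \<Rightarrow> 'g \<Rightarrow> ('g \<Rightarrow> 'r)" where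
  "group_ring_of R G g = (\<lambda>x\<in>carrier G. if x = g then \<one>\<^bsub>R\<^esub> else \<zero>\<^bsub>R\<^esub>)"

definition norm_element ::
    "('r, 'm) ring_scheme \<Rightarrow> ('g, 'n) monoid_scheme \<Rightarrow> ('g \<Rightarrow> 'r)" where
  "norm_element R G = (\<Oplus>\<^bsub>group_ring R G\<^esub>g\<in>carrier G. group_ring_of R G g)"


section \<open>Relative $K_2$ by Dennis--Stein symbols\<close>

definition ds_pairs :: "('a, 'm) ring_scheme \<Rightarrow> 'a set \<Rightarrow> ('a \<times> 'a) set" where
  "ds_pairs R I = carrier R \<times> I \<union> I \<times> carrier R"

text \<open>
  The free abelian group on the symbols is written additively, so a relation $u = v$ between
  products of symbols is recorded as the element $u - v$. The convention is the one with
  $\langle a,b\rangle\langle a,c\rangle = \langle a, b+c-abc\rangle$ (so $1-ab$ is the unit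
  attached to $\langle a,b\rangle$), not the one with $b+c+abc$.
\<close>

definition ds_relators ::
    "('a, 'm) ring_scheme \<Rightarrow> 'a set \<Rightarrow> ('a \<times> 'a \<Rightarrow>\<^sub>0 int) set" where
  "ds_relators R I =
     {frag_of (a, b) + frag_of (b, a) | a b. (a, b) \<in> ds_pairs R I} \<union>
     {frag_of (a, b) + frag_of (a, c)
        - frag_of (a, b \<oplus>\<^bsub>R\<^esub> c \<ominus>\<^bsub>R\<^esub> a \<otimes>\<^bsub>R\<^esub> b \<otimes>\<^bsub>R\<^esub> c) | a b c.
        (a, b) \<in> ds_pairs R I \<and> (a, c) \<in> ds_pairs R I
        \<and> (a, b \<oplus>\<^bsub>R\<^esub> c \<ominus>\<^bsub>R\<^esub> a \<otimes>\<^bsub>R\<^esub> b \<otimes>\<^bsub>R\<^esub> c) \<in> ds_pairs R I} \<union>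
     {frag_of (a, b \<otimes>\<^bsub>R\<^esub> c)
        - (frag_of (a \<otimes>\<^bsub>R\<^esub> b, c) + frag_of (a \<otimes>\<^bsub>R\<^esub> c, b)) | a b c.
        a \<in> carrier R \<and> b \<in> carrier R \<and> c \<in> carrier R \<and> (a \<in> I \<or> b \<in> I \<or> c \<in> I)}"

definition ds_relations ::
    "('a, 'm) ring_scheme \<Rightarrow> 'a set \<Rightarrow> ('a \<times> 'a \<Rightarrow>\<^sub>0 int) set" where
  "ds_relations R I = generate (free_Abelian_group (ds_pairs R I)) (ds_relators R I)"

text \<open>Only meaningful when \<open>R\<close> is a commutative ring and \<open>I\<close> is a radical ideal of \<open>R\<close>.\<close>

definition K2_rel ::
    "('a, 'm) ring_scheme \<Rightarrow> 'a set \<Rightarrow> ('a \<times> 'a \<Rightarrow>\<^sub>0 int) set monoid" where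
  "K2_rel R I = free_Abelian_group (ds_pairs R I) Mod ds_relations R I"

definition ds_symbol ::
    "('a, 'm) ring_scheme \<Rightarrow> 'a set \<Rightarrow> 'a \<Rightarrow> 'a \<Rightarrow> ('a \<times> 'a \<Rightarrow>\<^sub>0 int) set" where
  "ds_symbol R I a b =
     ds_relations R I #>\<^bsub>free_Abelian_group (ds_pairs R I)\<^esub> frag_of (a, b)"


section \<open>Elementary abelian groups\<close>

definition elementary_abelian_group :: "nat \<Rightarrow> ('a, 'm) monoid_scheme \<Rightarrow> bool" where
  "elementary_abelian_group p K \<longleftrightarrow>
     comm_group K \<and> (\<forall>x\<in>carrier K. x [^]\<^bsub>K\<^esub> p = \<one>\<^bsub>K\<^esub>)"

text \<open>
  An abelian group with addition \<open>(\<otimes>)\<close> and the scalar action $k \cdot x = x^k$. For an elementary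
  abelian $p$-group this is its vector space structure over the field
  \<^term>\<open>residue_ring (int p)\<close>, whose elements are the integers $0,\dots,p-1$. The fields
  \<^const>\<open>monoid.mult\<close> and \<^const>\<open>monoid.one\<close> of the record play no role in a module.
\<close>

definition power_module :: "('a, 'm) monoid_scheme \<Rightarrow> (int, 'a) module" where
  "power_module K =
    \<lparr>carrier = carrier K,
     monoid.mult = (\<lambda>x y. \<one>\<^bsub>K\<^esub>),
     monoid.one = \<one>\<^bsub>K\<^esub>,
     ring.zero = \<one>\<^bsub>K\<^esub>,
     ring.add = (\<lambda>x y. x \<otimes>\<^bsub>K\<^esub> y),
     smult = (\<lambda>k x. x [^]\<^bsub>K\<^esub> k)\<rparr>"

end

theory Submission
  imports Defs
begin

text \<open>
  Write $A = \mathbb{F}_p[G]$ and $N = \widetilde G$. Every group element fixes $N$, so $A$ acts on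
  the ideal $I = \mathbb{F}_p N$ through the augmentation $\varepsilon$, and $I$ is a line. The
  symbols are therefore all known once $D(a) = \langle a, N\rangle$ is known for $a \in A$: as
  $N^2 = 0$, (DS2) gives $\langle a, kN\rangle = D(a)^k$.

  Since $|G| > 2$, the element $N = \prod_i x_i^{p^{n_i}-1}$ is a product $uv$ of two elements of
  augmentation zero. Hence $\langle N, N\rangle = \langle uv, N\rangle = 1$ by (DS3), and this is
  what makes $D$ additive: (DS2) in the first variable says
  $D(a)D(b) = \langle a + b - abN, N\rangle$, and $abN$ is a multiple of $N$. Applied to
  $\langle a, bN\rangle$, (DS3) is the Leibniz rule
  $D(ab) = D(a)^{\varepsilon(b)} D(b)^{\varepsilon(a)}$. So $D$ is a derivation from $A$ to
  $K_2(A, I)$, on which $A$ acts through $\varepsilon$ (\<open>D_add\<close>, \<open>D_mult\<close>), and it is the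
  universal one: conversely, each derivation $d : A \to \mathbb{F}_p$ defines a homomorphism
  $K_2(A, I) \to \mathbb{F}_p$ with $D(a) \mapsto d(a)$
  (\<open>K2_rel_functional_of_derivation\<close>). In other words, $K_2(A,I)$ is $J/J^2$ for the
  augmentation ideal $J$.

  Both halves of the theorem follow. By the Leibniz rule, $D(gh) = D(g)D(h)$ on group elements, so
  $K_2(A, I)$ is generated by the $D(g_i)$, and $D(g_i) = D(x_i)$ because $D(1) = 1$. The exponent
  of $g_i$ is a homomorphism $G \to \mathbb{F}_p$ and extends to a derivation
  $d_i : A \to \mathbb{F}_p$ with $d_i(x_j) = \delta_{ij}$; the resulting functionals on
  $K_2(A, I)$ make the symbols independent (\<open>basis_by_dual_functionals\<close>).

  The formula for $N$ comes from $(g-1)^{q-1} = 1 + g + \dots + g^{q-1}$ for a power $q$ of $p$,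
  which holds since $(-1)^{q-1-k}\binom{q-1}{k} \equiv 1 \pmod p$
  (\<open>norm_element_factorisation\<close>).

  Functions with values in $\mathbb{F}_p$ are throughout represented by integer valued functions that
  satisfy their identities modulo $p$, so that calculations with them are about finite sums of
  integers.
\<close>

section \<open>Bases of elementary abelian groups\<close>

lemma (in comm_group) int_pow_mod_exponent:
  fixes k :: int and p :: nat
  assumes "a \<in> carrier G" "a [^] p = \<one>"
  shows "a [^] (k mod int p) = a [^] k"
proof -
  have "a [^] k = a [^] (int p * (k div int p) + k mod int p)"
    by simp
  also have "\<dots> = (a [^] int p) [^] (k div int p) \<otimes> a [^] (k mod int p)"
    using assms(1) by (simp only: int_pow_mult int_pow_pow)
  also have "\<dots> = a [^] (k mod int p)"
    using assms by (simp add: int_pow_int)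
  finally show ?thesis by simp
qed

lemma power_module_simps [simp]:
  "carrier (power_module K) = carrier K"
  "\<zero>\<^bsub>power_module K\<^esub> = \<one>\<^bsub>K\<^esub>"
  "x \<oplus>\<^bsub>power_module K\<^esub> y = x \<otimes>\<^bsub>K\<^esub> y"
  "k \<odot>\<^bsub>power_module K\<^esub> x = x [^]\<^bsub>K\<^esub> k"
  by (simp_all add: power_module_def)

lemma residue_ring_simps [simp]:
  "carrier (residue_ring m) = {0..m - 1}"
  "\<zero>\<^bsub>residue_ring m\<^esub> = 0"
  "\<one>\<^bsub>residue_ring m\<^esub> = 1"
  "x \<oplus>\<^bsub>residue_ring m\<^esub> y = (x + y) mod m"
  "x \<otimes>\<^bsub>residue_ring m\<^esub> y = (x * y) mod m"
  by (simp_all add: residue_ring_def)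

lemma residue_ring_field:
  assumes "prime p"
  shows "field (residue_ring (int p))"
proof -
  interpret residues_prime p "residue_ring (int p)"
    by unfold_locales (use assms in auto)
  show ?thesis by (rule is_field)
qed

lemma vectorspace_power_module:
  assumes p: "prime p" and K: "elementary_abelian_group p K"
  shows "vectorspace (residue_ring (int p)) (power_module K)"
proof -
  interpret field "residue_ring (int p)"
    by (rule residue_ring_field[OF p])
  interpret K: comm_group K
    using K by (simp add: elementary_abelian_group_def)
  have exp: "x [^]\<^bsub>K\<^esub> (k mod int p) = x [^]\<^bsub>K\<^esub> k" if "x \<in> carrier K" for x and k :: int
    using K that by (intro K.int_pow_mod_exponent) (auto simp: elementary_abelian_group_def)
  have "module (residue_ring (int p)) (power_module K)"
  proof (rule moduleI)
    show "cring (residue_ring (int p))" ..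
    show "abelian_group (power_module K)"
    proof (rule abelian_groupI)
      fix x assume "x \<in> carrier (power_module K)"
      then show "\<exists>y\<in>carrier (power_module K).
          y \<oplus>\<^bsub>power_module K\<^esub> x = \<zero>\<^bsub>power_module K\<^esub>"
        by (auto intro!: bexI[of _ "inv\<^bsub>K\<^esub> x"])
    qed (auto simp: K.m_ac)
  qed (auto simp: exp K.int_pow_distrib K.int_pow_mult K.int_pow_pow mult.commute)
  then show ?thesis
    by (intro vectorspace.intro) (auto intro: field_axioms)
qed

text \<open>
  A linear relation $\prod_i b_i^{a_i} = 1$ is carried by the \<open>j\<close>-th functional to
  $a_j \equiv 0$, which gives independence; the spanning half is the hypothesis on subgroups, as
  the span of the family is one.
\<close>

lemma basis_by_dual_functionals:
  fixes \<phi> :: "nat \<Rightarrow> 'a \<Rightarrow> int"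
  assumes p: "prime p" and K: "elementary_abelian_group p K"
    and b: "\<And>i. i \<in> {1..r} \<Longrightarrow> b i \<in> carrier K"
    and gen: "\<And>H. subgroup H K \<Longrightarrow> b ` {1..r} \<subseteq> H \<Longrightarrow> carrier K \<subseteq> H"
    and add: "\<And>j x y. j \<in> {1..r} \<Longrightarrow> x \<in> carrier K \<Longrightarrow> y \<in> carrier K \<Longrightarrow>
      [\<phi> j (x \<otimes>\<^bsub>K\<^esub> y) = \<phi> j x + \<phi> j y] (mod int p)"
    and delta: "\<And>i j. i \<in> {1..r} \<Longrightarrow> j \<in> {1..r} \<Longrightarrow>
      [\<phi> j (b i) = (if i = j then 1 else 0)] (mod int p)"
  shows "vectorspace.dim (residue_ring (int p)) (power_module K) = r
    \<and> inj_on b {1..r}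
    \<and> vectorspace.basis (residue_ring (int p)) (power_module K) (b ` {1..r})"
proof -
  interpret vectorspace "residue_ring (int p)" "power_module K"
    by (rule vectorspace_power_module[OF p K])
  interpret K: comm_group K
    using K by (simp add: elementary_abelian_group_def)
  have p1: "1 < int p"
    using prime_gt_1_nat[OF p] by simp
  have inj: "inj_on b {1..r}"
  proof (rule inj_onI, rule ccontr)
    fix i j assume ij: "i \<in> {1..r}" "j \<in> {1..r}" "b i = b j" "i \<noteq> j"
    then have "[1 = 0] (mod int p)"
      using delta[of i i] delta[of j i] by (auto simp: cong_def)
    then show False
      using p1 by (auto simp: cong_def)
  qed
  have one: "[\<phi> j \<one>\<^bsub>K\<^esub> = 0] (mod int p)" if "j \<in> {1..r}" for j
    using add[OF that, of "\<one>\<^bsub>K\<^esub>" "\<one>\<^bsub>K\<^esub>"]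
    by (simp add: cong_iff_dvd_diff)
  have npow: "[\<phi> j (x [^]\<^bsub>K\<^esub> m) = int m * \<phi> j x] (mod int p)"
    if "j \<in> {1..r}" "x \<in> carrier K" for j x and m :: nat
  proof (induction m)
    case (Suc m)
    have "[\<phi> j (x [^]\<^bsub>K\<^esub> Suc m) = \<phi> j (x [^]\<^bsub>K\<^esub> m) + \<phi> j x] (mod int p)"
      using add[OF that(1), of "x [^]\<^bsub>K\<^esub> m" x] that by simp
    also have "[\<phi> j (x [^]\<^bsub>K\<^esub> m) + \<phi> j x = int m * \<phi> j x + \<phi> j x] (mod int p)"
      by (intro cong_add Suc cong_refl)
    finally show ?case by (simp add: algebra_simps)
  qed (use one that in simp)
  have comb: "[\<phi> j (lincomb a B) = (\<Sum>v\<in>B. a v * \<phi> j v)] (mod int p)"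
    if "finite B" "B \<subseteq> carrier K" "a \<in> B \<rightarrow> {0..int p - 1}" "j \<in> {1..r}" for a B j
    using that
  proof (induction B rule: finite_induct)
    case empty
    then show ?case using one by (simp add: lincomb_def)
  next
    case (insert v B)
    have av: "a v = int (nat (a v))"
      using insert by auto
    have v: "v [^]\<^bsub>K\<^esub> a v \<in> carrier K" "v \<in> carrier K"
      using insert by auto
    have lc: "lincomb a B \<in> carrier K"
      using insert lincomb_closed[of B a] by auto
    have "lincomb a (insert v B) = v [^]\<^bsub>K\<^esub> a v \<otimes>\<^bsub>K\<^esub> lincomb a B"
      unfolding lincomb_def using insert by (subst finsum_insert) (auto simp: Pi_iff)
    then have "[\<phi> j (lincomb a (insert v B)) = \<phi> j (v [^]\<^bsub>K\<^esub> a v) + \<phi> j (lincomb a B)] (mod int p)"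
      using add[OF insert.prems(3) v(1) lc] by simp
    also have "[\<phi> j (v [^]\<^bsub>K\<^esub> a v) + \<phi> j (lincomb a B)
        = a v * \<phi> j v + (\<Sum>v\<in>B. a v * \<phi> j v)] (mod int p)"
    proof (intro cong_add)
      show "[\<phi> j (v [^]\<^bsub>K\<^esub> a v) = a v * \<phi> j v] (mod int p)"
        using npow[OF insert.prems(3) v(2), of "nat (a v)"] av
        by (metis int_pow_int)
    qed (use insert in auto)
    finally show ?case using insert by simp
  qed
  have indpt: "\<not> lin_dep (b ` {1..r})"
  proof
    assume "lin_dep (b ` {1..r})"
    then obtain B a v where B: "finite B" "B \<subseteq> b ` {1..r}" "a \<in> B \<rightarrow> {0..int p - 1}"
      "lincomb a B = \<one>\<^bsub>K\<^esub>" "v \<in> B" "a v \<noteq> 0"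
      unfolding lin_dep_def by auto
    from B obtain j where j: "j \<in> {1..r}" "v = b j" by auto
    have "[0 = \<phi> j (lincomb a B)] (mod int p)"
      using one[OF j(1)] B by (simp add: cong_sym)
    also have "[\<phi> j (lincomb a B) = (\<Sum>w\<in>B. a w * \<phi> j w)] (mod int p)"
      by (rule comb[OF B(1) _ B(3) j(1)]) (use B(2) b in blast)
    also have "[(\<Sum>w\<in>B. a w * \<phi> j w) = (\<Sum>w\<in>B. a w * (if w = v then 1 else 0))] (mod int p)"
    proof (intro cong_sum cong_mult cong_refl)
      fix w assume "w \<in> B"
      then obtain i where i: "i \<in> {1..r}" "w = b i" using B by auto
      show "[\<phi> j w = (if w = v then 1 else 0)] (mod int p)"
        using delta[OF i(1) j(1)] inj_on_eq_iff[OF inj i(1) j(1)] i(2) j(2) by simp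
    qed
    also have "(\<Sum>w\<in>B. a w * (if w = v then 1 else 0)) = a v"
      using B by (simp add: if_distrib cong: if_cong)
    finally have "int p dvd a v"
      by (auto simp: cong_def mod_eq_0_iff_dvd)
    moreover have "0 \<le> a v" "a v < int p"
      using B by auto
    ultimately show False
      using B(6) zdvd_imp_le[of "int p" "a v"] by auto
  qed
  have sub: "b ` {1..r} \<subseteq> carrier (power_module K)"
    using b by auto
  have submod: "submodule (residue_ring (int p)) (span (b ` {1..r})) (power_module K)"
    by (rule span_is_submodule[OF sub])
  have "subgroup (span (b ` {1..r})) K"
  proof (rule K.subgroupI)
    show "span (b ` {1..r}) \<subseteq> carrier K"
      using span_is_subset2[OF sub] by simp
    show "span (b ` {1..r}) \<noteq> {}"
      using submodule.zero_closed[OF submod] by auto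
    fix x assume x: "x \<in> span (b ` {1..r})"
    then have xK: "x \<in> carrier K"
      using span_is_subset2[OF sub] by auto
    \<comment> \<open>A submodule contains inverses because $x^{-1} = x^{p-1}$.\<close>
    have "x [^]\<^bsub>K\<^esub> (int p - 1) \<in> span (b ` {1..r})"
      using submodule.smult_closed[OF submod, of "int p - 1" x] x p1 by simp
    moreover have "x [^]\<^bsub>K\<^esub> (int p - 1) = inv\<^bsub>K\<^esub> x"
    proof -
      have "x [^]\<^bsub>K\<^esub> (int p - 1) = x [^]\<^bsub>K\<^esub> int p \<otimes>\<^bsub>K\<^esub> inv\<^bsub>K\<^esub> x"
        using xK by (simp add: K.int_pow_diff)
      then show ?thesis
        using K xK by (simp add: elementary_abelian_group_def int_pow_int)
    qed
    ultimately show "inv\<^bsub>K\<^esub> x \<in> span (b ` {1..r})" by simp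
    fix y assume "y \<in> span (b ` {1..r})"
    then show "x \<otimes>\<^bsub>K\<^esub> y \<in> span (b ` {1..r})"
      using submodule.m_closed[OF submod x] by simp
  qed
  then have "carrier K \<subseteq> span (b ` {1..r})"
    by (rule gen) (use in_own_span[OF sub] in auto)
  then have basis: "basis (b ` {1..r})"
    unfolding basis_def using indpt sub span_is_subset2[OF sub] by auto
  moreover have "dim = r"
    using dim_basis[OF _ basis] card_image[OF inj] by simp
  ultimately show ?thesis
    using inj by simp
qed

section \<open>The relative symbol group\<close>

locale cring_ideal = cring R + ideal I R for I and R (structure)
begin

lemma ds_pairs_subset: "ds_pairs R I \<subseteq> carrier R \<times> carrier R"
  using a_subset by (auto simp: ds_pairs_def)

lemma ds_pairs_mult:
  assumes "a \<in> carrier R" "b \<in> carrier R" "c \<in> carrier R" "a \<in> I \<or> b \<in> I \<or> c \<in> I"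
  shows "(a, b \<otimes> c) \<in> ds_pairs R I" "(a \<otimes> b, c) \<in> ds_pairs R I" "(a \<otimes> c, b) \<in> ds_pairs R I"
  using assms by (auto simp: ds_pairs_def I_l_closed I_r_closed)

lemma keys_ds_relator:
  assumes "c \<in> ds_relators R I"
  shows "Poly_Mapping.keys c \<subseteq> ds_pairs R I"
proof -
  let ?F = "free_Abelian_group (ds_pairs R I)"
  interpret F: comm_group ?F
    by (rule abelian_free_Abelian_group)
  have add: "x + y \<in> carrier ?F" if "x \<in> carrier ?F" "y \<in> carrier ?F" for x y
    using F.m_closed[OF that] by simp
  have diff: "x - y \<in> carrier ?F" if "x \<in> carrier ?F" "y \<in> carrier ?F" for x y
    using add[of x "- y"] that by simp
  have of: "frag_of u \<in> carrier ?F" if "u \<in> ds_pairs R I" for u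
    using that by simp
  have swap: "(b, a) \<in> ds_pairs R I" if "(a, b) \<in> ds_pairs R I" for a b
    using that by (auto simp: ds_pairs_def)
  have "c \<in> carrier ?F"
    using assms unfolding ds_relators_def
  proof (elim UnE CollectE exE conjE)
    fix a b assume "c = frag_of (a, b) + frag_of (b, a)" "(a, b) \<in> ds_pairs R I"
    then show ?thesis using swap by (simp only:) (intro add of)
  next
    fix a b b' assume "c = frag_of (a, b) + frag_of (a, b') - frag_of (a, b \<oplus> b' \<ominus> a \<otimes> b \<otimes> b')"
      "(a, b) \<in> ds_pairs R I" "(a, b') \<in> ds_pairs R I" "(a, b \<oplus> b' \<ominus> a \<otimes> b \<otimes> b') \<in> ds_pairs R I"
    then show ?thesis by (simp only:) (intro add diff of)
  next
    fix a b d assume "c = frag_of (a, b \<otimes> d) - (frag_of (a \<otimes> b, d) + frag_of (a \<otimes> d, b))"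
      "a \<in> carrier R" "b \<in> carrier R" "d \<in> carrier R" "a \<in> I \<or> b \<in> I \<or> d \<in> I"
    then show ?thesis using ds_pairs_mult[of a b d] by (simp only: not_False_eq_True simp_thms) (intro add diff of; simp)
  qed
  then show ?thesis by simp
qed

lemma ds_relators_closed: "ds_relators R I \<subseteq> carrier (free_Abelian_group (ds_pairs R I))"
  using keys_ds_relator by auto

lemma normal_ds_relations: "ds_relations R I \<lhd> free_Abelian_group (ds_pairs R I)"
proof -
  interpret F: comm_group "free_Abelian_group (ds_pairs R I)"
    by (rule abelian_free_Abelian_group)
  show ?thesis
    unfolding ds_relations_def
    by (rule F.subgroup_imp_normal, rule F.generate_is_subgroup, rule ds_relators_closed)
qed

sublocale K: comm_group "K2_rel R I"
proof -
  interpret F: comm_group "free_Abelian_group (ds_pairs R I)"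
    by (rule abelian_free_Abelian_group)
  show "comm_group (K2_rel R I)"
    unfolding K2_rel_def
    by (rule F.abelian_FactGroup, rule normal_imp_subgroup, rule normal_ds_relations)
qed

definition word_class :: "('a \<times> 'a \<Rightarrow>\<^sub>0 int) \<Rightarrow> ('a \<times> 'a \<Rightarrow>\<^sub>0 int) set" where
  "word_class c = ds_relations R I #>\<^bsub>free_Abelian_group (ds_pairs R I)\<^esub> c"

lemma carrier_K2_rel: "carrier (K2_rel R I) = word_class ` {c. Poly_Mapping.keys c \<subseteq> ds_pairs R I}"
  by (auto simp: K2_rel_def carrier_FactGroup word_class_def)

lemma word_class_closed [simp]:
  "Poly_Mapping.keys c \<subseteq> ds_pairs R I \<Longrightarrow> word_class c \<in> carrier (K2_rel R I)"
  by (auto simp: carrier_K2_rel)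

lemma word_class_add:
  assumes "Poly_Mapping.keys c \<subseteq> ds_pairs R I" "Poly_Mapping.keys d \<subseteq> ds_pairs R I"
  shows "word_class (c + d) = word_class c \<otimes>\<^bsub>K2_rel R I\<^esub> word_class d"
  using normal.rcos_sum[OF normal_ds_relations, of c d] assms
  by (simp add: K2_rel_def word_class_def)

lemma word_class_minus:
  assumes "Poly_Mapping.keys c \<subseteq> ds_pairs R I"
  shows "word_class (- c) = inv\<^bsub>K2_rel R I\<^esub> word_class c"
proof -
  have "word_class 0 \<otimes>\<^bsub>K2_rel R I\<^esub> word_class 0 = word_class 0"
    using word_class_add[of 0 0] by simp
  then have "word_class 0 = \<one>\<^bsub>K2_rel R I\<^esub>"
    by (subst (asm) K.r_cancel_one) simp_all
  then show ?thesis
    using word_class_add[of "- c" c] assms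
    by (intro K.inv_equality[symmetric]) auto
qed

lemma word_class_diff:
  assumes "Poly_Mapping.keys c \<subseteq> ds_pairs R I" "Poly_Mapping.keys d \<subseteq> ds_pairs R I"
  shows "word_class (c - d) = word_class c \<otimes>\<^bsub>K2_rel R I\<^esub> inv\<^bsub>K2_rel R I\<^esub> word_class d"
  using word_class_add[of c "- d"] word_class_minus[of d] assms by simp

lemma word_class_relator:
  assumes "c \<in> ds_relators R I"
  shows "word_class c = \<one>\<^bsub>K2_rel R I\<^esub>"
proof -
  have "c \<in> ds_relations R I"
    using assms by (auto simp: ds_relations_def intro: generate.incl)
  moreover have "subgroup (ds_relations R I) (free_Abelian_group (ds_pairs R I))"
    by (rule normal_imp_subgroup, rule normal_ds_relations)
  ultimately show ?thesis
    using keys_ds_relator[OF assms]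
    by (simp add: word_class_def K2_rel_def)
      (intro group.coset_join2, auto)
qed

lemma word_class_eqI:
  assumes "Poly_Mapping.keys d \<subseteq> ds_pairs R I" "c - d \<in> ds_relators R I"
  shows "word_class c = word_class d"
proof -
  have "word_class (c - d + d) = word_class (c - d) \<otimes>\<^bsub>K2_rel R I\<^esub> word_class d"
    using assms(1) keys_ds_relator[OF assms(2)] by (intro word_class_add)
  then show ?thesis
    using assms by (simp add: word_class_relator)
qed

abbreviation symb :: "'a \<Rightarrow> 'a \<Rightarrow> ('a \<times> 'a \<Rightarrow>\<^sub>0 int) set" where
  "symb a b \<equiv> ds_symbol R I a b"

lemma symb_eq_word_class: "symb a b = word_class (frag_of (a, b))"
  by (simp add: ds_symbol_def word_class_def)

lemma symb_closed [simp]: "(a, b) \<in> ds_pairs R I \<Longrightarrow> symb a b \<in> carrier (K2_rel R I)"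
  by (simp add: symb_eq_word_class)

lemma symb_swap:
  assumes "(a, b) \<in> ds_pairs R I"
  shows "symb a b \<otimes>\<^bsub>K2_rel R I\<^esub> symb b a = \<one>\<^bsub>K2_rel R I\<^esub>"
proof -
  have ba: "(b, a) \<in> ds_pairs R I"
    using assms by (auto simp: ds_pairs_def)
  have "frag_of (a, b) + frag_of (b, a) \<in> ds_relators R I"
    using assms unfolding ds_relators_def by blast
  then show ?thesis
    using word_class_relator[of "frag_of (a, b) + frag_of (b, a)"] assms ba
    by (simp add: symb_eq_word_class word_class_add)
qed

lemma symb_add:
  assumes "(a, b) \<in> ds_pairs R I" "(a, c) \<in> ds_pairs R I"
  shows "symb a b \<otimes>\<^bsub>K2_rel R I\<^esub> symb a c = symb a (b \<oplus> c \<ominus> a \<otimes> b \<otimes> c)"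
proof -
  let ?d = "b \<oplus> c \<ominus> a \<otimes> b \<otimes> c"
  \<comment> \<open>If \<open>a\<close> is not in \<open>I\<close>, then \<open>b\<close> and \<open>c\<close> are, so that the symbol on the right
    is defined whenever the two on the left are.\<close>
  have d: "(a, ?d) \<in> ds_pairs R I"
  proof (cases "a \<in> I")
    case True
    moreover have "b \<in> carrier R" "c \<in> carrier R"
      using assms ds_pairs_subset by auto
    ultimately show ?thesis
      using Icarr[OF True] by (auto simp: ds_pairs_def)
  next
    case False
    then have "b \<in> I" "c \<in> I" "a \<in> carrier R"
      using assms by (auto simp: ds_pairs_def)
    then show ?thesis
      by (auto simp: ds_pairs_def a_minus_def I_l_closed I_r_closed)
  qed
  have "frag_of (a, b) + frag_of (a, c) - frag_of (a, ?d) \<in> ds_relators R I"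
    unfolding ds_relators_def
    by (rule UnI1, rule UnI2, rule CollectI, intro exI conjI, rule refl) (fact assms d)+
  then have "word_class (frag_of (a, b) + frag_of (a, c)) = word_class (frag_of (a, ?d))"
    using d by (intro word_class_eqI) simp_all
  then show ?thesis
    using assms by (simp add: symb_eq_word_class word_class_add)
qed

lemma symb_mult:
  assumes "a \<in> carrier R" "b \<in> carrier R" "c \<in> carrier R" "a \<in> I \<or> b \<in> I \<or> c \<in> I"
  shows "symb a (b \<otimes> c) = symb (a \<otimes> b) c \<otimes>\<^bsub>K2_rel R I\<^esub> symb (a \<otimes> c) b"
proof -
  have P: "(a, b \<otimes> c) \<in> ds_pairs R I" "(a \<otimes> b, c) \<in> ds_pairs R I" "(a \<otimes> c, b) \<in> ds_pairs R I"
    using ds_pairs_mult[OF assms] .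
  have "frag_of (a, b \<otimes> c) - (frag_of (a \<otimes> b, c) + frag_of (a \<otimes> c, b)) \<in> ds_relators R I"
    using assms unfolding ds_relators_def by blast
  then have "word_class (frag_of (a, b \<otimes> c)) = word_class (frag_of (a \<otimes> b, c) + frag_of (a \<otimes> c, b))"
    using P keys_add[of "frag_of (a \<otimes> b, c)" "frag_of (a \<otimes> c, b)"]
    by (intro word_class_eqI) auto
  then show ?thesis
    using P by (simp add: symb_eq_word_class word_class_add)
qed

lemma K2_rel_generated_by_symbols:
  assumes H: "subgroup H (K2_rel R I)" and symb: "\<And>a b. (a, b) \<in> ds_pairs R I \<Longrightarrow> symb a b \<in> H"
  shows "carrier (K2_rel R I) \<subseteq> H"
proof -
  have "word_class c \<in> H" if "Poly_Mapping.keys c \<subseteq> ds_pairs R I" for c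
    using that
  proof (rule free_Abelian_group_induct)
    have "word_class (0 - 0) \<in> carrier (K2_rel R I)" by simp
    then show "word_class 0 \<in> H"
      using word_class_diff[of 0 0] subgroup.one_closed[OF H] by simp
  next
    fix x y
    assume "Poly_Mapping.keys x \<subseteq> ds_pairs R I" "Poly_Mapping.keys y \<subseteq> ds_pairs R I"
      "word_class x \<in> H" "word_class y \<in> H"
    then show "word_class (x - y) \<in> H"
      by (simp add: word_class_diff subgroup.m_closed[OF H] subgroup.m_inv_closed[OF H])
  next
    fix a assume "a \<in> ds_pairs R I"
    then show "word_class (frag_of a) \<in> H"
      using symb[of "fst a" "snd a"] by (simp add: symb_eq_word_class)
  qed
  then show ?thesis
    by (auto simp: carrier_K2_rel)
qed

text \<open>
  The universal property of a presentation by generators and relations, for homomorphisms to the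
  integers modulo \<open>m\<close>.
\<close>

lemma K2_rel_functional:
  fixes f :: "'a \<Rightarrow> 'a \<Rightarrow> int" and m :: int
  assumes swap: "\<And>a b. (a, b) \<in> ds_pairs R I \<Longrightarrow> [f a b + f b a = 0] (mod m)"
    and add: "\<And>a b c. (a, b) \<in> ds_pairs R I \<Longrightarrow> (a, c) \<in> ds_pairs R I \<Longrightarrow>
      [f a b + f a c = f a (b \<oplus> c \<ominus> a \<otimes> b \<otimes> c)] (mod m)"
    and mult: "\<And>a b c. a \<in> carrier R \<Longrightarrow> b \<in> carrier R \<Longrightarrow> c \<in> carrier R \<Longrightarrow>
      a \<in> I \<or> b \<in> I \<or> c \<in> I \<Longrightarrow> [f a (b \<otimes> c) = f (a \<otimes> b) c + f (a \<otimes> c) b] (mod m)"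
  obtains \<phi> where
    "\<And>X Y. X \<in> carrier (K2_rel R I) \<Longrightarrow> Y \<in> carrier (K2_rel R I) \<Longrightarrow>
      [\<phi> (X \<otimes>\<^bsub>K2_rel R I\<^esub> Y) = \<phi> X + \<phi> Y] (mod m)"
    "\<And>a b. (a, b) \<in> ds_pairs R I \<Longrightarrow> [\<phi> (symb a b) = f a b] (mod m)"
proof -
  \<comment> \<open>The free abelian group on one point \<open>()\<close> stands for the integers.\<close>
  define \<Phi> where "\<Phi> c = poly_mapping.lookup (frag_extend (\<lambda>(a, b). frag_cmul (f a b) (frag_of ())) c) ()" for c
  have \<Phi>_add: "\<Phi> (c + d) = \<Phi> c + \<Phi> d" for c d
    by (simp add: \<Phi>_def frag_extend_add lookup_add)
  have \<Phi>_diff: "\<Phi> (c - d) = \<Phi> c - \<Phi> d" for c d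
    by (simp add: \<Phi>_def frag_extend_diff lookup_minus)
  have \<Phi>_of: "\<Phi> (frag_of (a, b)) = f a b" for a b
    by (simp add: \<Phi>_def)
  have relator: "m dvd \<Phi> c" if "c \<in> ds_relators R I" for c
    using that swap add mult unfolding ds_relators_def
    by (auto simp: \<Phi>_add \<Phi>_diff \<Phi>_of cong_iff_dvd_diff)
  have relation: "m dvd \<Phi> c" if "c \<in> ds_relations R I" for c
    using that unfolding ds_relations_def
  proof (induction rule: generate.induct)
    case one
    then show ?case by (simp add: \<Phi>_def)
  next
    case (incl h)
    then show ?case by (rule relator)
  next
    case (inv h)
    then have "Poly_Mapping.keys h \<subseteq> ds_pairs R I"
      by (rule keys_ds_relator)
    then show ?case
      using relator[OF inv] \<Phi>_diff[of 0 h] by (simp add: \<Phi>_def)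
  next
    case (eng h1 h2)
    then show ?case by (simp add: \<Phi>_add)
  qed
  define \<phi> where "\<phi> X = \<Phi> (SOME c. c \<in> X)" for X
  have \<phi>: "[\<phi> (word_class c) = \<Phi> c] (mod m)" if "Poly_Mapping.keys c \<subseteq> ds_pairs R I" for c
  proof -
    have "subgroup (ds_relations R I) (free_Abelian_group (ds_pairs R I))"
      by (rule normal_imp_subgroup, rule normal_ds_relations)
    from subgroup.one_closed[OF this] have "0 + c \<in> word_class c"
      unfolding word_class_def r_coset_def by (intro UN_I[of 0]) simp_all
    then have "(SOME d. d \<in> word_class c) \<in> word_class c"
      by (rule someI)
    then obtain d where "d \<in> ds_relations R I" "(SOME d. d \<in> word_class c) = d + c"
      by (auto simp: word_class_def r_coset_def)
    then show ?thesis
      using relation[of d] by (simp add: \<phi>_def \<Phi>_add cong_iff_dvd_diff)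
  qed
  show ?thesis
  proof (rule that[of \<phi>])
    fix X Y assume "X \<in> carrier (K2_rel R I)" "Y \<in> carrier (K2_rel R I)"
    then obtain c d where cd: "Poly_Mapping.keys c \<subseteq> ds_pairs R I" "X = word_class c"
      "Poly_Mapping.keys d \<subseteq> ds_pairs R I" "Y = word_class d"
      by (auto simp: carrier_K2_rel)
    have "Poly_Mapping.keys (c + d) \<subseteq> ds_pairs R I"
      using cd keys_add[of c d] by blast
    then have "[\<phi> (word_class (c + d)) = \<Phi> c + \<Phi> d] (mod m)"
      using \<phi>[of "c + d"] by (simp add: \<Phi>_add)
    moreover have "[\<phi> X + \<phi> Y = \<Phi> c + \<Phi> d] (mod m)"
      using cd \<phi> by (auto intro: cong_add)
    ultimately show "[\<phi> (X \<otimes>\<^bsub>K2_rel R I\<^esub> Y) = \<phi> X + \<phi> Y] (mod m)"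
      using cd by (simp add: word_class_add cong_def)
  next
    fix a b assume "(a, b) \<in> ds_pairs R I"
    then show "[\<phi> (symb a b) = f a b] (mod m)"
      using \<phi>[of "frag_of (a, b)"] by (simp add: symb_eq_word_class \<Phi>_of)
  qed
qed

end

section \<open>Symbols over a line ideal\<close>

text \<open>
  The situation of the norm element, without the group: as an additive group, \<open>I\<close> is generated by
  \<open>N\<close> and isomorphic to the integers modulo \<open>p\<close>. The ring acts on it
  by \<open>\<epsilon>\<close>, and \<open>\<nu>\<close> reads off the coordinate of a multiple of \<open>N\<close>. As \<open>N\<close> is
  a product of two elements that annihilate it, \<open>I\<close> has square zero.
\<close>

locale socle_line = cring_ideal I R for I and R (structure) +
  fixes p :: nat and N u v and \<epsilon> \<nu> :: "'a \<Rightarrow> int"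
  assumes socle_eq: "I = range (\<lambda>k :: int. [k] \<cdot> N)"
    and N_closed [simp]: "N \<in> carrier R"
    and u_closed [simp]: "u \<in> carrier R"
    and v_closed [simp]: "v \<in> carrier R"
    and act_N: "\<And>a. a \<in> carrier R \<Longrightarrow> a \<otimes> N = [\<epsilon> a] \<cdot> N"
    and exponent_N: "[int p] \<cdot> N = \<zero>"
    and coordinate: "\<And>k :: int. [\<nu> ([k] \<cdot> N) = k] (mod int p)"
    and N_factors: "N = u \<otimes> v"
    and u_N: "u \<otimes> N = \<zero>"
    and v_N: "v \<otimes> N = \<zero>"
begin

abbreviation D :: "'a \<Rightarrow> ('a \<times> 'a \<Rightarrow>\<^sub>0 int) set" where
  "D a \<equiv> symb a N"

abbreviation (input) K where "K \<equiv> K2_rel R I"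

lemma zero_multiple [simp]: "[(0 :: int)] \<cdot> x = \<zero>"
  by (simp add: add_pow_def)

lemma multiple_in_socle [simp]: "[(k :: int)] \<cdot> N \<in> I"
  by (auto simp: socle_eq)

lemma N_in_socle [simp]: "N \<in> I"
  using multiple_in_socle[of 1] by simp

lemma socle_pairs [simp]:
  assumes "a \<in> carrier R" "x \<in> I"
  shows "(a, x) \<in> ds_pairs R I" "(x, a) \<in> ds_pairs R I"
  using assms by (auto simp: ds_pairs_def)

lemma socle_mult_zero:
  assumes "x \<in> I" "y \<in> I"
  shows "x \<otimes> y = \<zero>"
proof -
  have "N \<otimes> N = u \<otimes> (v \<otimes> N)"
    by (simp add: N_factors m_assoc)
  then have N2: "N \<otimes> N = \<zero>"
    by (simp add: v_N)
  obtain k l :: int where "x = [k] \<cdot> N" "y = [l] \<cdot> N"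
    using assms by (auto simp: socle_eq)
  then show ?thesis
    by (simp add: add_pow_ldistr_int add_pow_rdistr_int N2 add.int_pow_one)
qed

lemma symb_socle_add:
  assumes "a \<in> carrier R" "x \<in> I" "y \<in> I"
  shows "symb a (x \<oplus> y) = symb a x \<otimes>\<^bsub>K\<^esub> symb a y"
proof -
  have xy: "x \<in> carrier R" "y \<in> carrier R"
    using assms Icarr by auto
  have "a \<otimes> x \<otimes> y = \<zero>"
    using assms(1) xy socle_mult_zero[OF assms(2,3)] by (simp add: m_assoc)
  then have "x \<oplus> y \<ominus> a \<otimes> x \<otimes> y = x \<oplus> y"
    using xy by (simp add: a_minus_def)
  then show ?thesis
    using symb_add[of a x y] assms by simp
qed

lemma symb_socle_multiple:
  assumes "a \<in> carrier R"
  shows "symb a ([(k :: int)] \<cdot> N) = D a [^]\<^bsub>K\<^esub> k"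
proof -
  let ?h = "\<lambda>k :: int. symb a ([k] \<cdot> N)"
  have h: "?h \<in> hom integer_group K"
  proof (rule homI)
    fix k l :: int assume "k \<in> carrier integer_group" "l \<in> carrier integer_group"
    show "?h (k \<otimes>\<^bsub>integer_group\<^esub> l) = ?h k \<otimes>\<^bsub>K\<^esub> ?h l"
      using assms symb_socle_add[of a "[k] \<cdot> N" "[l] \<cdot> N"] by (simp add: add.int_pow_mult)
  qed (use assms in simp)
  have "?h (1 [^]\<^bsub>integer_group\<^esub> k) = ?h 1 [^]\<^bsub>K\<^esub> k"
    by (rule hom_int_pow[OF h]) (simp_all add: K.is_group)
  then show ?thesis by simp
qed

lemma symb_swap_inv:
  assumes "(a, b) \<in> ds_pairs R I"
  shows "symb b a = inv\<^bsub>K\<^esub> symb a b"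
proof -
  have "(b, a) \<in> ds_pairs R I"
    using assms by (auto simp: ds_pairs_def)
  then show ?thesis
    using symb_swap[of b a] assms by (intro K.inv_equality[symmetric]) auto
qed

lemma D_power_p:
  assumes "a \<in> carrier R"
  shows "D a [^]\<^bsub>K\<^esub> p = \<one>\<^bsub>K\<^esub>"
proof -
  have "D a [^]\<^bsub>K\<^esub> int p = D a [^]\<^bsub>K\<^esub> (0 :: int)"
    using symb_socle_multiple[OF assms, of "int p"] symb_socle_multiple[OF assms, of 0]
    by (simp add: exponent_N)
  then show ?thesis by (simp add: int_pow_int)
qed

lemma symb_zero:
  assumes "a \<in> carrier R"
  shows "symb a \<zero> = \<one>\<^bsub>K\<^esub>" "symb \<zero> a = \<one>\<^bsub>K\<^esub>"
proof -
  show *: "symb a \<zero> = \<one>\<^bsub>K\<^esub>"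
    using symb_socle_multiple[OF assms, of 0] by simp
  have "\<zero> \<in> I"
    using multiple_in_socle[of 0] by simp
  then show "symb \<zero> a = \<one>\<^bsub>K\<^esub>"
    using symb_swap_inv[of a \<zero>] assms * by simp
qed

text \<open>
  The square of $\langle N,N\rangle$ is trivial by (DS1), and so is its \<open>p\<close>-th power; for
  $p = 2$ this says nothing more, and the factorisation $N = uv$ is what kills it.
\<close>

lemma D_N: "D N = \<one>\<^bsub>K\<^esub>"
proof -
  have "symb u (v \<otimes> N) = symb (u \<otimes> v) N \<otimes>\<^bsub>K\<^esub> symb (u \<otimes> N) v"
    by (rule symb_mult) auto
  then show ?thesis
    by (simp add: v_N u_N symb_zero flip: N_factors)
qed

text \<open>
  By (DS2), $\langle N,a\rangle\langle N,b\rangle = \langle N, a+b-Nab\rangle$. The correction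
  $Nab$ is a multiple of $N$, and shifting the second entry by such a multiple changes the symbol by
  a power of $\langle N,N\rangle = 1$.
\<close>

lemma D_add:
  assumes a: "a \<in> carrier R" and b: "b \<in> carrier R"
  shows "D (a \<oplus> b) = D a \<otimes>\<^bsub>K\<^esub> D b"
proof -
  define m where "m = - (\<epsilon> (a \<otimes> b))"
  have shift: "symb N (x \<oplus> [m] \<cdot> N) = symb N x" if x: "x \<in> carrier R" for x
  proof -
    have "N \<otimes> x \<in> I"
      using x by (simp add: I_r_closed)
    then have "N \<otimes> x \<otimes> [m] \<cdot> N = \<zero>"
      by (simp add: socle_mult_zero)
    then have "symb N x \<otimes>\<^bsub>K\<^esub> symb N ([m] \<cdot> N) = symb N (x \<oplus> [m] \<cdot> N)"
      using symb_add[of N x "[m] \<cdot> N"] x by (simp add: a_minus_def)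
    then show ?thesis
      using x by (simp add: symb_socle_multiple D_N)
  qed
  have "N \<otimes> a \<otimes> b = [\<epsilon> (a \<otimes> b)] \<cdot> N"
    using a b act_N[of "a \<otimes> b"] by (simp add: m_ac)
  then have "\<ominus> (N \<otimes> a \<otimes> b) = [m] \<cdot> N"
    by (simp add: m_def add.int_pow_neg)
  then have "symb N a \<otimes>\<^bsub>K\<^esub> symb N b = symb N (a \<oplus> b \<oplus> [m] \<cdot> N)"
    using symb_add[of N a b] a b by (simp add: a_minus_def)
  then have "inv\<^bsub>K\<^esub> D a \<otimes>\<^bsub>K\<^esub> inv\<^bsub>K\<^esub> D b = inv\<^bsub>K\<^esub> D (a \<oplus> b)"
    using a b by (simp add: shift flip: symb_swap_inv)
  then have "inv\<^bsub>K\<^esub> (inv\<^bsub>K\<^esub> (D a \<otimes>\<^bsub>K\<^esub> D b)) = inv\<^bsub>K\<^esub> (inv\<^bsub>K\<^esub> D (a \<oplus> b))"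
    using a b by (simp add: K.inv_mult)
  then show ?thesis
    using a b by simp
qed

lemma D_multiple:
  assumes "a \<in> carrier R"
  shows "D ([(k :: int)] \<cdot> a) = D a [^]\<^bsub>K\<^esub> k"
proof -
  have "D \<in> hom (add_monoid R) K"
    by (rule homI) (simp_all add: D_add)
  then have "D (a [^]\<^bsub>add_monoid R\<^esub> k) = D a [^]\<^bsub>K\<^esub> k"
    by (rule hom_int_pow) (use assms in \<open>simp_all add: K.is_group a_group\<close>)
  then show ?thesis
    by (simp add: add_pow_def)
qed

lemma D_one: "D \<one> = \<one>\<^bsub>K\<^esub>"
proof -
  have "symb \<one> (\<one> \<otimes> N) = D (\<one> \<otimes> \<one>) \<otimes>\<^bsub>K\<^esub> symb (\<one> \<otimes> N) \<one>"
    by (rule symb_mult) auto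
  then show ?thesis
    using symb_swap_inv[of \<one> N] by simp
qed

lemma D_finsum_mem:
  assumes H: "subgroup H K" and "finite S" "f \<in> S \<rightarrow> carrier R"
    and "\<And>s. s \<in> S \<Longrightarrow> D (f s) \<in> H"
  shows "D (finsum R f S) \<in> H"
  using assms(2-)
proof (induction S rule: finite_induct)
  case empty
  then show ?case
    using symb_zero(2)[of N] subgroup.one_closed[OF H] by simp
next
  case (insert s S)
  then show ?case
    using subgroup.m_closed[OF H] by (simp add: D_add Pi_iff)
qed

text \<open>
  (DS3) for $\langle a, bN\rangle = \langle ab, N\rangle\langle aN, b\rangle$, with
  $aN = \varepsilon(a)N$ and $bN = \varepsilon(b)N$.
\<close>

lemma D_mult:
  assumes a: "a \<in> carrier R" and b: "b \<in> carrier R"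
  shows "D (a \<otimes> b) = D a [^]\<^bsub>K\<^esub> \<epsilon> b \<otimes>\<^bsub>K\<^esub> D b [^]\<^bsub>K\<^esub> \<epsilon> a"
proof -
  have "symb a (b \<otimes> N) = D (a \<otimes> b) \<otimes>\<^bsub>K\<^esub> symb (a \<otimes> N) b"
    using a b by (intro symb_mult) auto
  moreover have "symb ([k] \<cdot> N) b = inv\<^bsub>K\<^esub> (D b [^]\<^bsub>K\<^esub> k)" for k :: int
    using b symb_swap_inv[of b "[k] \<cdot> N"] by (simp add: symb_socle_multiple)
  ultimately have "D a [^]\<^bsub>K\<^esub> \<epsilon> b = D (a \<otimes> b) \<otimes>\<^bsub>K\<^esub> inv\<^bsub>K\<^esub> (D b [^]\<^bsub>K\<^esub> \<epsilon> a)"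
    using a b by (simp add: act_N symb_socle_multiple)
  then show ?thesis
    using a b by (simp add: K.m_assoc)
qed

lemma K2_rel_generated_by_D:
  assumes H: "subgroup H K" and D: "\<And>a. a \<in> carrier R \<Longrightarrow> D a \<in> H"
  shows "carrier K \<subseteq> H"
proof (rule K2_rel_generated_by_symbols[OF H])
  have *: "symb a x \<in> H" if "a \<in> carrier R" "x \<in> I" for a x
  proof -
    obtain k :: int where "x = [k] \<cdot> N"
      using \<open>x \<in> I\<close> by (auto simp: socle_eq)
    then show ?thesis
      using that D[of a] K.subgroup_int_pow_closed[OF H] by (simp add: symb_socle_multiple)
  qed
  fix a b assume "(a, b) \<in> ds_pairs R I"
  then consider "a \<in> carrier R" "b \<in> I" | "a \<in> I" "b \<in> carrier R"
    by (auto simp: ds_pairs_def)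
  then show "symb a b \<in> H"
  proof cases
    case 2
    then show ?thesis
      using *[of b a] symb_swap_inv[of b a] subgroup.m_inv_closed[OF H] by simp
  qed (rule *)
qed

lemma elementary_abelian_K2_rel: "elementary_abelian_group p K"
proof -
  have "subgroup {x \<in> carrier K. x [^]\<^bsub>K\<^esub> p = \<one>\<^bsub>K\<^esub>} K"
    by (rule K.subgroupI) (auto simp: K.pow_mult_distrib K.m_comm K.nat_pow_inv intro: exI[of _ "\<one>\<^bsub>K\<^esub>"])
  then have "carrier K \<subseteq> {x \<in> carrier K. x [^]\<^bsub>K\<^esub> p = \<one>\<^bsub>K\<^esub>}"
    by (rule K2_rel_generated_by_D) (simp add: D_power_p)
  then show ?thesis
    using K.comm_group_axioms by (auto simp: elementary_abelian_group_def)
qed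

lemma annihilator_augmentation:
  assumes "a \<in> carrier R" "a \<otimes> N = \<zero>"
  shows "[\<epsilon> a = 0] (mod int p)"
  using coordinate[of "\<epsilon> a"] coordinate[of 0] assms act_N[of a]
  by (simp add: cong_def)

text \<open>
  On $\langle a, kN\rangle$ the functional has to be $k\,d(a)$, and on $\langle kN, b\rangle$ it has
  to be $-k\,d(b)$ by (DS1). The two prescriptions agree on $I \times I$ because $d$ vanishes on
  $I$: by the Leibniz rule, $d(kuv) = d(ku)\varepsilon(v) + \varepsilon(ku)d(v)$, and $u$ and $v$
  annihilate $N$, so that $\varepsilon$ vanishes on $ku$ and $v$.
\<close>

lemma K2_rel_functional_of_derivation:
  fixes d :: "'a \<Rightarrow> int"
  assumes d_add: "\<And>a b. a \<in> carrier R \<Longrightarrow> b \<in> carrier R \<Longrightarrow> [d (a \<oplus> b) = d a + d b] (mod int p)"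
    and d_mult: "\<And>a b. a \<in> carrier R \<Longrightarrow> b \<in> carrier R \<Longrightarrow>
      [d (a \<otimes> b) = d a * \<epsilon> b + \<epsilon> a * d b] (mod int p)"
  obtains \<phi> where
    "\<And>X Y. X \<in> carrier K \<Longrightarrow> Y \<in> carrier K \<Longrightarrow> [\<phi> (X \<otimes>\<^bsub>K\<^esub> Y) = \<phi> X + \<phi> Y] (mod int p)"
    "\<And>a. a \<in> carrier R \<Longrightarrow> [\<phi> (D a) = d a] (mod int p)"
proof -
  have d_socle: "[d x = 0] (mod int p)" if "x \<in> I" for x
  proof -
    obtain k :: int where "x = [k] \<cdot> N"
      using \<open>x \<in> I\<close> by (auto simp: socle_eq)
    then have x: "x = [k] \<cdot> u \<otimes> v"
      by (simp add: N_factors add_pow_ldistr_int)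
    have "[k] \<cdot> u \<otimes> N = \<zero>"
      by (simp add: add_pow_ldistr_int u_N add.int_pow_one)
    then have "[\<epsilon> ([k] \<cdot> u) = 0] (mod int p)" "[\<epsilon> v = 0] (mod int p)"
      by (auto intro!: annihilator_augmentation v_N)
    then have "[d ([k] \<cdot> u) * \<epsilon> v + \<epsilon> ([k] \<cdot> u) * d v = d ([k] \<cdot> u) * 0 + 0 * d v] (mod int p)"
      by (intro cong_add cong_mult cong_refl)
    then show ?thesis
      using d_mult[of "[k] \<cdot> u" v] by (simp add: x cong_def)
  qed
  have \<nu>_add: "[\<nu> (x \<oplus> y) = \<nu> x + \<nu> y] (mod int p)" if x: "x \<in> I" and y: "y \<in> I" for x y
  proof -
    obtain k l :: int where kl: "x = [k] \<cdot> N" "y = [l] \<cdot> N"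
      using x y by (auto simp: socle_eq)
    have "[\<nu> (x \<oplus> y) = k + l] (mod int p)"
      using coordinate[of "k + l"] by (simp add: kl add.int_pow_mult)
    also have "[k + l = \<nu> x + \<nu> y] (mod int p)"
      unfolding kl by (intro cong_add cong_sym[OF coordinate])
    finally show ?thesis .
  qed
  have \<nu>_mult: "[\<nu> (a \<otimes> x) = \<epsilon> a * \<nu> x] (mod int p)" if a: "a \<in> carrier R" and x: "x \<in> I" for a x
  proof -
    obtain k :: int where k: "x = [k] \<cdot> N"
      using x by (auto simp: socle_eq)
    have "a \<otimes> x = [(\<epsilon> a * k)] \<cdot> N"
      using a by (simp add: k add_pow_rdistr_int act_N add.int_pow_pow)
    then have "[\<nu> (a \<otimes> x) = \<epsilon> a * k] (mod int p)"
      using coordinate[of "\<epsilon> a * k"] by simp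
    also have "[\<epsilon> a * k = \<epsilon> a * \<nu> x] (mod int p)"
      unfolding k by (intro cong_mult cong_refl cong_sym[OF coordinate])
    finally show ?thesis .
  qed
  \<comment> \<open>On $I \times I$ the first case applies; \<open>f_left\<close> says that this choice does not matter
    modulo \<open>p\<close>.\<close>
  define f where "f a b = (if b \<in> I then d a * \<nu> b else - (d b * \<nu> a))" for a b
  have f_right: "f a x = d a * \<nu> x" if "x \<in> I" for a x
    using that by (simp add: f_def)
  have f_left: "[f x b = - (d b * \<nu> x)] (mod int p)" if "x \<in> I" for x b
  proof (cases "b \<in> I")
    case True
    have "[d x * \<nu> b = 0 * \<nu> b] (mod int p)" "[d b * \<nu> x = 0 * \<nu> x] (mod int p)"
      by (rule cong_mult[OF d_socle[OF that] cong_refl], rule cong_mult[OF d_socle[OF True] cong_refl])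
    then show ?thesis
      using True by (simp add: f_def cong_iff_dvd_diff)
  qed (simp add: f_def)
  have f_add: "[f a b + f a c = f a (b \<oplus> c \<ominus> a \<otimes> b \<otimes> c)] (mod int p)"
    if ab: "(a, b) \<in> ds_pairs R I" and ac: "(a, c) \<in> ds_pairs R I" for a b c
  proof -
    have carr: "a \<in> carrier R" "b \<in> carrier R" "c \<in> carrier R"
      using ab ac ds_pairs_subset by auto
    show ?thesis
    proof (cases "a \<in> I")
      case True
      then have abc: "\<ominus> (a \<otimes> b \<otimes> c) \<in> I"
        using carr by (simp add: I_r_closed)
      have "[d (b \<oplus> c \<oplus> \<ominus> (a \<otimes> b \<otimes> c)) = d (b \<oplus> c) + d (\<ominus> (a \<otimes> b \<otimes> c))] (mod int p)"
        using carr by (intro d_add) auto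
      also have "[d (b \<oplus> c) + d (\<ominus> (a \<otimes> b \<otimes> c)) = d b + d c + 0] (mod int p)"
        using carr abc by (intro cong_add d_add d_socle)
      finally have "[d (b \<oplus> c \<ominus> a \<otimes> b \<otimes> c) = d b + d c] (mod int p)"
        by (simp add: a_minus_def)
      then have "[- (d (b \<oplus> c \<ominus> a \<otimes> b \<otimes> c) * \<nu> a) = - ((d b + d c) * \<nu> a)] (mod int p)"
        unfolding cong_minus_minus_iff by (rule cong_mult[OF _ cong_refl])
      moreover have "[f a b + f a c = - (d b * \<nu> a) + - (d c * \<nu> a)] (mod int p)"
        using True by (intro cong_add f_left)
      moreover have "[f a (b \<oplus> c \<ominus> a \<otimes> b \<otimes> c) = - (d (b \<oplus> c \<ominus> a \<otimes> b \<otimes> c) * \<nu> a)] (mod int p)"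
        using True by (intro f_left)
      ultimately show ?thesis
        by (simp add: cong_def algebra_simps)
    next
      case False
      then have bc: "b \<in> I" "c \<in> I"
        using ab ac by (auto simp: ds_pairs_def)
      have "b \<oplus> c \<ominus> a \<otimes> b \<otimes> c = b \<oplus> c"
        using carr socle_mult_zero[OF bc] by (simp add: m_assoc a_minus_def)
      moreover have "[d a * \<nu> (b \<oplus> c) = d a * (\<nu> b + \<nu> c)] (mod int p)"
        using bc by (intro cong_mult cong_refl \<nu>_add)
      ultimately show ?thesis
        using bc by (simp add: f_right algebra_simps cong_sym)
    qed
  qed
  have f_mult: "[f a (b \<otimes> c) = f (a \<otimes> b) c + f (a \<otimes> c) b] (mod int p)"
    if a: "a \<in> carrier R" and b: "b \<in> carrier R" and c: "c \<in> carrier R"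
      and I: "a \<in> I \<or> b \<in> I \<or> c \<in> I" for a b c
  proof -
    \<comment> \<open>The cases $b \in I$ and $c \in I$ are the same up to exchanging \<open>b\<close> and \<open>c\<close>.\<close>
    have right: "[f a (b \<otimes> x) = f (a \<otimes> b) x + f (a \<otimes> x) b] (mod int p)"
      if a: "a \<in> carrier R" and b: "b \<in> carrier R" and x: "x \<in> I" for a b x
    proof -
      have "[f a (b \<otimes> x) = d a * (\<epsilon> b * \<nu> x)] (mod int p)"
        using f_right[of "b \<otimes> x" a] I_l_closed[OF x b] cong_mult[OF cong_refl \<nu>_mult[OF b x]] by simp
      moreover have "[f (a \<otimes> b) x = (d a * \<epsilon> b + \<epsilon> a * d b) * \<nu> x] (mod int p)"
        using f_right[OF x, of "a \<otimes> b"] cong_mult[OF d_mult[OF a b] cong_refl] by simp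
      moreover have "[f (a \<otimes> x) b = - (d b * (\<epsilon> a * \<nu> x))] (mod int p)"
      proof (rule cong_trans[OF f_left])
        show "a \<otimes> x \<in> I" using I_l_closed[OF x a] .
        show "[- (d b * \<nu> (a \<otimes> x)) = - (d b * (\<epsilon> a * \<nu> x))] (mod int p)"
          unfolding cong_minus_minus_iff by (rule cong_mult[OF cong_refl \<nu>_mult[OF a x]])
      qed
      ultimately show ?thesis
        using cong_add[of "f (a \<otimes> b) x" _ "int p" "f (a \<otimes> x) b"]
        by (fastforce simp: cong_def algebra_simps)
    qed
    consider "c \<in> I" | "b \<in> I" | "a \<in> I" using I by auto
    then show ?thesis
    proof cases
      case 1
      then show ?thesis using right a b by simp
    next
      case 2
      then show ?thesis using right[of a c b] a c Icarr by (simp add: m_comm add.commute)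
    next
      case 3
      have "[f a (b \<otimes> c) = - (d (b \<otimes> c) * \<nu> a)] (mod int p)"
        using 3 by (rule f_left)
      moreover have "[- (d (b \<otimes> c) * \<nu> a) = - ((d b * \<epsilon> c + \<epsilon> b * d c) * \<nu> a)] (mod int p)"
        unfolding cong_minus_minus_iff by (rule cong_mult[OF d_mult[OF b c] cong_refl])
      moreover have left: "[f (a \<otimes> y) z = - (d z * (\<epsilon> y * \<nu> a))] (mod int p)"
        if y: "y \<in> carrier R" for y z
        unfolding m_comm[OF a y]
      proof (rule cong_trans[OF f_left])
        show "y \<otimes> a \<in> I" using I_l_closed[OF 3 y] .
        show "[- (d z * \<nu> (y \<otimes> a)) = - (d z * (\<epsilon> y * \<nu> a))] (mod int p)"
          unfolding cong_minus_minus_iff by (rule cong_mult[OF cong_refl \<nu>_mult[OF y 3]])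
      qed
      have "[f (a \<otimes> b) c + f (a \<otimes> c) b = - (d c * (\<epsilon> b * \<nu> a)) + - (d b * (\<epsilon> c * \<nu> a))] (mod int p)"
        using b c by (intro cong_add left)
      ultimately show ?thesis
        by (simp add: cong_def algebra_simps)
    qed
  qed
  have f_swap: "[f a b + f b a = 0] (mod int p)" if ab: "(a, b) \<in> ds_pairs R I" for a b
  proof -
    consider "a \<in> I" | "b \<in> I" using ab by (auto simp: ds_pairs_def)
    then show ?thesis
    proof cases
      case 1
      then show ?thesis
        using cong_add[OF f_left[OF 1, of b] cong_refl[of "f b a"]] f_right[OF 1, of b] by simp
    next
      case 2
      then show ?thesis
        using cong_add[OF cong_refl[of "f a b"] f_left[OF 2, of a]] f_right[OF 2, of a] by simp
    qed
  qed
  obtain \<phi> where \<phi>: "\<And>X Y. X \<in> carrier K \<Longrightarrow> Y \<in> carrier K \<Longrightarrow>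
      [\<phi> (X \<otimes>\<^bsub>K\<^esub> Y) = \<phi> X + \<phi> Y] (mod int p)"
    "\<And>a b. (a, b) \<in> ds_pairs R I \<Longrightarrow> [\<phi> (symb a b) = f a b] (mod int p)"
    using K2_rel_functional[of f "int p", OF f_swap f_add f_mult] by blast
  show ?thesis
  proof (rule that[of \<phi>, OF \<phi>(1)])
    fix a assume a: "a \<in> carrier R"
    have "[d a * \<nu> N = d a * 1] (mod int p)"
      using coordinate[of 1] by (intro cong_mult cong_refl) simp
    then show "[\<phi> (D a) = d a] (mod int p)"
      using \<phi>(2)[of a N] a by (simp add: f_right cong_def)
  qed
qed

end

section \<open>Group rings modulo a prime\<close>

lemma (in residues) finsum_residues:
  assumes "finite S" "f \<in> S \<rightarrow> {0..m - 1}"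
  shows "finsum R f S = (\<Sum>x\<in>S. f x) mod m"
proof -
  interpret cring R by (rule cring)
  show ?thesis
    using assms
  proof (induction S rule: finite_induct)
    case empty
    have "finsum R f {} = \<zero>" by simp
    also have "\<zero> = 0" by (simp add: R_m_def)
    finally show ?case by simp
  next
    case (insert x S)
    then have "finsum R f (insert x S) = (f x + finsum R f S) mod m"
      by (subst finsum_insert) (auto simp: R_m_def)
    then show ?case
      using insert by (simp add: mod_simps)
  qed
qed

locale modular_group_ring = comm_group G for G (structure) +
  fixes p :: nat
  assumes prime_p: "prime p" and finite_G: "finite (carrier G)"
begin

abbreviation F where "F \<equiv> residue_ring (int p)"
abbreviation A where "A \<equiv> group_ring F G"
abbreviation el where "el \<equiv> group_ring_of F G"

text \<open>
  The linear functional on the group ring given by its values \<open>w\<close> on group elements. An element of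
  the group ring is determined by its pairings modulo \<open>p\<close> (\<open>A_eqI\<close>), and
  \<open>pairing_mult\<close> turns convolution into iterated pairing. Thus the ring axioms, and later all
  identities in the group ring, become identities of finite sums of integers.
\<close>

definition pairing :: "('a \<Rightarrow> int) \<Rightarrow> ('a \<Rightarrow> int) \<Rightarrow> int" where
  "pairing f w = (\<Sum>x\<in>carrier G. f x * w x)"

lemma p_gt_1: "1 < int p"
  using prime_gt_1_nat[OF prime_p] by simp

lemma carrier_A: "carrier A = carrier G \<rightarrow>\<^sub>E {0..int p - 1}"
  using finite_G by (simp add: group_ring_def)

lemma A_value: "f \<in> carrier A \<Longrightarrow> x \<in> carrier G \<Longrightarrow> f x \<in> {0..int p - 1}"
  by (auto simp: carrier_A)

lemma A_value_mod: "f \<in> carrier A \<Longrightarrow> x \<in> carrier G \<Longrightarrow> f x mod int p = f x"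
  using A_value[of f x] by auto

lemma restrict_mod_in_A: "(\<lambda>x\<in>carrier G. f x mod int p) \<in> carrier A"
  using p_gt_1 by (auto simp: carrier_A)

lemma zero_A: "\<zero>\<^bsub>A\<^esub> = (\<lambda>x\<in>carrier G. 0)"
  by (simp add: group_ring_def)

lemma one_A: "\<one>\<^bsub>A\<^esub> = el \<one>"
  by (simp add: group_ring_def group_ring_of_def)

lemma add_A: "f \<oplus>\<^bsub>A\<^esub> h = (\<lambda>x\<in>carrier G. (f x + h x) mod int p)"
  by (simp add: group_ring_def)

lemma mult_A:
  assumes f: "f \<in> carrier A" and h: "h \<in> carrier A"
  shows "f \<otimes>\<^bsub>A\<^esub> h = (\<lambda>x\<in>carrier G. (\<Sum>y\<in>carrier G. f y * h (inv y \<otimes> x)) mod int p)"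
proof -
  interpret residues "int p" F
    by unfold_locales (rule p_gt_1)
  have "(\<Oplus>\<^bsub>F\<^esub>y\<in>{y \<in> carrier G. f y \<noteq> 0}. (f y * h (inv y \<otimes> x)) mod int p)
      = (\<Sum>y\<in>carrier G. f y * h (inv y \<otimes> x)) mod int p" if "x \<in> carrier G" for x
  proof -
    have "(\<Oplus>\<^bsub>F\<^esub>y\<in>{y \<in> carrier G. f y \<noteq> 0}. (f y * h (inv y \<otimes> x)) mod int p)
        = (\<Sum>y\<in>{y \<in> carrier G. f y \<noteq> 0}. (f y * h (inv y \<otimes> x)) mod int p) mod int p"
      using finite_G p_gt_1 by (intro finsum_residues) auto
    also have "\<dots> = (\<Sum>y\<in>{y \<in> carrier G. f y \<noteq> 0}. f y * h (inv y \<otimes> x)) mod int p"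
      by (simp add: mod_sum_eq)
    also have "(\<Sum>y\<in>{y \<in> carrier G. f y \<noteq> 0}. f y * h (inv y \<otimes> x))
        = (\<Sum>y\<in>carrier G. f y * h (inv y \<otimes> x))"
      using finite_G by (intro sum.mono_neutral_left) auto
    finally show ?thesis .
  qed
  then show ?thesis
    by (auto simp: group_ring_def)
qed

lemma el_in_A [simp]: "el g \<in> carrier A"
  using p_gt_1 by (auto simp: carrier_A group_ring_of_def)

lemma A_closed [simp]:
  "\<zero>\<^bsub>A\<^esub> \<in> carrier A" "\<one>\<^bsub>A\<^esub> \<in> carrier A"
  "f \<oplus>\<^bsub>A\<^esub> h \<in> carrier A"
  "f \<in> carrier A \<Longrightarrow> h \<in> carrier A \<Longrightarrow> f \<otimes>\<^bsub>A\<^esub> h \<in> carrier A"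
  using p_gt_1 restrict_mod_in_A
  by (simp_all add: one_A add_A mult_A) (auto simp: carrier_A zero_A)

lemma pairing_cong: "(\<And>x. x \<in> carrier G \<Longrightarrow> w x = w' x) \<Longrightarrow> pairing f w = pairing f w'"
  by (simp add: pairing_def)

lemma pairing_weight_cong:
  "(\<And>x. x \<in> carrier G \<Longrightarrow> [w x = w' x] (mod int p)) \<Longrightarrow> [pairing f w = pairing f w'] (mod int p)"
  unfolding pairing_def by (intro cong_sum cong_mult cong_refl)

lemma pairing_weight_add: "pairing f (\<lambda>x. w x + w' x) = pairing f w + pairing f w'"
  by (simp add: pairing_def algebra_simps sum.distrib)

lemma pairing_weight_scale: "pairing f (\<lambda>x. k * w x) = k * pairing f w"
  by (simp add: pairing_def algebra_simps sum_distrib_left)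

lemma pairing_mod: "[pairing (\<lambda>x\<in>carrier G. f x mod int p) w = pairing f w] (mod int p)"
  unfolding pairing_def by (intro cong_sum) (simp add: cong_def mod_simps)

lemma A_eqI:
  assumes f: "f \<in> carrier A" and h: "h \<in> carrier A"
    and eq: "\<And>w. [pairing f w = pairing h w] (mod int p)"
  shows "f = h"
proof (rule extensionalityI[of _ "carrier G"])
  show "f \<in> extensional (carrier G)" "h \<in> extensional (carrier G)"
    using f h by (auto simp: carrier_A PiE_def)
  fix x assume x: "x \<in> carrier G"
  have "pairing f' (\<lambda>y. if y = x then 1 else 0) = f' x" for f'
    using x finite_G by (simp add: pairing_def if_distrib cong: if_cong)
  then have "f x mod int p = h x mod int p"
    using eq[of "\<lambda>y. if y = x then 1 else 0"] by (simp add: cong_def)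
  then show "f x = h x"
    using A_value_mod[OF f x] A_value_mod[OF h x] by simp
qed

lemma pairing_el: "g \<in> carrier G \<Longrightarrow> pairing (el g) w = w g"
  using finite_G by (simp add: pairing_def group_ring_of_def if_distrib[of "\<lambda>z. z * _"] cong: if_cong)

lemma pairing_zero: "pairing \<zero>\<^bsub>A\<^esub> w = 0"
  by (simp add: pairing_def zero_A)

lemma pairing_add: "[pairing (f \<oplus>\<^bsub>A\<^esub> h) w = pairing f w + pairing h w] (mod int p)"
  using pairing_mod[of "\<lambda>x. f x + h x" w]
  by (simp add: add_A) (simp add: pairing_def algebra_simps sum.distrib)

lemma sum_translate:
  assumes "y \<in> carrier G"
  shows "(\<Sum>x\<in>carrier G. f x) = (\<Sum>z\<in>carrier G. f (y \<otimes> z))"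
  by (rule sum.reindex_bij_witness[of _ "\<lambda>z. y \<otimes> z" "\<lambda>x. inv y \<otimes> x"])
    (use assms in \<open>auto simp: inv_solve_left m_assoc[symmetric]\<close>)

lemma pairing_mult:
  assumes f: "f \<in> carrier A" and h: "h \<in> carrier A"
  shows "[pairing (f \<otimes>\<^bsub>A\<^esub> h) w = pairing f (\<lambda>y. pairing h (\<lambda>z. w (y \<otimes> z)))] (mod int p)"
proof -
  have "[pairing (f \<otimes>\<^bsub>A\<^esub> h) w
      = (\<Sum>x\<in>carrier G. (\<Sum>y\<in>carrier G. f y * h (inv y \<otimes> x)) * w x)] (mod int p)"
    using pairing_mod[of "\<lambda>x. \<Sum>y\<in>carrier G. f y * h (inv y \<otimes> x)" w] f h
    by (simp add: mult_A) (simp add: pairing_def)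
  also have "(\<Sum>x\<in>carrier G. (\<Sum>y\<in>carrier G. f y * h (inv y \<otimes> x)) * w x)
      = (\<Sum>y\<in>carrier G. \<Sum>x\<in>carrier G. f y * h (inv y \<otimes> x) * w x)"
    by (simp add: sum_distrib_right) (rule sum.swap)
  also have "\<dots> = (\<Sum>y\<in>carrier G. \<Sum>z\<in>carrier G. f y * h z * w (y \<otimes> z))"
  proof (rule sum.cong[OF refl])
    fix y assume y: "y \<in> carrier G"
    show "(\<Sum>x\<in>carrier G. f y * h (inv y \<otimes> x) * w x) = (\<Sum>z\<in>carrier G. f y * h z * w (y \<otimes> z))"
      by (subst sum_translate[OF y]) (use y in \<open>auto simp: m_assoc[symmetric] intro!: sum.cong\<close>)
  qed
  also have "\<dots> = pairing f (\<lambda>y. pairing h (\<lambda>z. w (y \<otimes> z)))"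
    by (simp add: pairing_def sum_distrib_left algebra_simps)
  finally show ?thesis .
qed

lemma cring_A: "cring A"
proof -
  note pm = pairing_mult and pa = pairing_add
  have comm: "f \<otimes>\<^bsub>A\<^esub> h = h \<otimes>\<^bsub>A\<^esub> f" if fh: "f \<in> carrier A" "h \<in> carrier A" for f h
  proof (rule A_eqI)
    fix w
    have "[pairing (f \<otimes>\<^bsub>A\<^esub> h) w = pairing f (\<lambda>y. pairing h (\<lambda>z. w (y \<otimes> z)))] (mod int p)"
      using fh by (rule pm)
    also have "pairing f (\<lambda>y. pairing h (\<lambda>z. w (y \<otimes> z)))
        = pairing h (\<lambda>z. pairing f (\<lambda>y. w (z \<otimes> y)))"
      by (simp add: pairing_def sum_distrib_left, subst sum.swap)
        (intro sum.cong refl, simp add: m_comm)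
    also have "[\<dots> = pairing (h \<otimes>\<^bsub>A\<^esub> f) w] (mod int p)"
      using fh by (intro cong_sym[OF pm])
    finally show "[pairing (f \<otimes>\<^bsub>A\<^esub> h) w = pairing (h \<otimes>\<^bsub>A\<^esub> f) w] (mod int p)" .
  qed (use fh in simp_all)
  have assoc: "f \<otimes>\<^bsub>A\<^esub> h \<otimes>\<^bsub>A\<^esub> k = f \<otimes>\<^bsub>A\<^esub> (h \<otimes>\<^bsub>A\<^esub> k)"
    if fhk: "f \<in> carrier A" "h \<in> carrier A" "k \<in> carrier A" for f h k
  proof (rule A_eqI)
    fix w
    have "[pairing (f \<otimes>\<^bsub>A\<^esub> h \<otimes>\<^bsub>A\<^esub> k) w
        = pairing (f \<otimes>\<^bsub>A\<^esub> h) (\<lambda>y. pairing k (\<lambda>z. w (y \<otimes> z)))] (mod int p)"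
      using fhk by (intro pm) simp_all
    also have "[pairing (f \<otimes>\<^bsub>A\<^esub> h) (\<lambda>y. pairing k (\<lambda>z. w (y \<otimes> z)))
        = pairing f (\<lambda>x. pairing h (\<lambda>y. pairing k (\<lambda>z. w (x \<otimes> y \<otimes> z))))] (mod int p)"
      using fhk by (intro pm)
    also have "pairing f (\<lambda>x. pairing h (\<lambda>y. pairing k (\<lambda>z. w (x \<otimes> y \<otimes> z))))
        = pairing f (\<lambda>x. pairing h (\<lambda>y. pairing k (\<lambda>z. w (x \<otimes> (y \<otimes> z)))))"
      by (intro pairing_cong) (simp add: m_assoc)
    also have "[\<dots> = pairing f (\<lambda>x. pairing (h \<otimes>\<^bsub>A\<^esub> k) (\<lambda>y. w (x \<otimes> y)))] (mod int p)"
      using fhk by (intro pairing_weight_cong cong_sym[OF pm])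
    also have "[pairing f (\<lambda>x. pairing (h \<otimes>\<^bsub>A\<^esub> k) (\<lambda>y. w (x \<otimes> y)))
        = pairing (f \<otimes>\<^bsub>A\<^esub> (h \<otimes>\<^bsub>A\<^esub> k)) w] (mod int p)"
      using fhk by (intro cong_sym[OF pm]) simp_all
    finally show "[pairing (f \<otimes>\<^bsub>A\<^esub> h \<otimes>\<^bsub>A\<^esub> k) w
        = pairing (f \<otimes>\<^bsub>A\<^esub> (h \<otimes>\<^bsub>A\<^esub> k)) w] (mod int p)" .
  qed (use fhk in simp_all)
  have distr: "(f \<oplus>\<^bsub>A\<^esub> h) \<otimes>\<^bsub>A\<^esub> k = f \<otimes>\<^bsub>A\<^esub> k \<oplus>\<^bsub>A\<^esub> h \<otimes>\<^bsub>A\<^esub> k"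
    if fhk: "f \<in> carrier A" "h \<in> carrier A" "k \<in> carrier A" for f h k
  proof (rule A_eqI)
    fix w
    let ?w = "\<lambda>y. pairing k (\<lambda>z. w (y \<otimes> z))"
    have "[pairing ((f \<oplus>\<^bsub>A\<^esub> h) \<otimes>\<^bsub>A\<^esub> k) w = pairing (f \<oplus>\<^bsub>A\<^esub> h) ?w] (mod int p)"
      using fhk by (intro pm) simp_all
    also have "[pairing (f \<oplus>\<^bsub>A\<^esub> h) ?w = pairing f ?w + pairing h ?w] (mod int p)"
      by (rule pa)
    also have "[pairing f ?w + pairing h ?w
        = pairing (f \<otimes>\<^bsub>A\<^esub> k) w + pairing (h \<otimes>\<^bsub>A\<^esub> k) w] (mod int p)"
      using fhk by (intro cong_add cong_sym[OF pm])
    also have "[pairing (f \<otimes>\<^bsub>A\<^esub> k) w + pairing (h \<otimes>\<^bsub>A\<^esub> k) w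
        = pairing (f \<otimes>\<^bsub>A\<^esub> k \<oplus>\<^bsub>A\<^esub> h \<otimes>\<^bsub>A\<^esub> k) w] (mod int p)"
      by (rule cong_sym[OF pa])
    finally show "[pairing ((f \<oplus>\<^bsub>A\<^esub> h) \<otimes>\<^bsub>A\<^esub> k) w
        = pairing (f \<otimes>\<^bsub>A\<^esub> k \<oplus>\<^bsub>A\<^esub> h \<otimes>\<^bsub>A\<^esub> k) w] (mod int p)" .
  qed (use fhk in simp_all)
  have one: "\<one>\<^bsub>A\<^esub> \<otimes>\<^bsub>A\<^esub> f = f" if f: "f \<in> carrier A" for f
  proof (rule A_eqI)
    fix w
    have "[pairing (\<one>\<^bsub>A\<^esub> \<otimes>\<^bsub>A\<^esub> f) w
        = pairing \<one>\<^bsub>A\<^esub> (\<lambda>y. pairing f (\<lambda>z. w (y \<otimes> z)))] (mod int p)"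
      using f by (intro pm) simp_all
    also have "pairing \<one>\<^bsub>A\<^esub> (\<lambda>y. pairing f (\<lambda>z. w (y \<otimes> z))) = pairing f w"
      by (simp add: one_A pairing_el) (intro pairing_cong, simp)
    finally show "[pairing (\<one>\<^bsub>A\<^esub> \<otimes>\<^bsub>A\<^esub> f) w = pairing f w] (mod int p)" .
  qed (use f in simp_all)
  have "abelian_group A"
  proof (rule abelian_groupI)
    fix f h k assume f: "f \<in> carrier A" and h: "h \<in> carrier A" and k: "k \<in> carrier A"
    show "f \<oplus>\<^bsub>A\<^esub> h \<oplus>\<^bsub>A\<^esub> k = f \<oplus>\<^bsub>A\<^esub> (h \<oplus>\<^bsub>A\<^esub> k)"
      by (auto simp: add_A mod_simps add_ac)
    show "f \<oplus>\<^bsub>A\<^esub> h = h \<oplus>\<^bsub>A\<^esub> f"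
      by (simp add: add_A add.commute)
    show "\<zero>\<^bsub>A\<^esub> \<oplus>\<^bsub>A\<^esub> f = f"
    proof (rule A_eqI)
      fix w show "[pairing (\<zero>\<^bsub>A\<^esub> \<oplus>\<^bsub>A\<^esub> f) w = pairing f w] (mod int p)"
        using pa[of "\<zero>\<^bsub>A\<^esub>" f w] by (simp add: pairing_zero)
    qed (use f in simp_all)
    have "(\<lambda>x\<in>carrier G. (- f x) mod int p) \<oplus>\<^bsub>A\<^esub> f = \<zero>\<^bsub>A\<^esub>"
      by (auto simp: add_A zero_A mod_simps)
    then show "\<exists>h\<in>carrier A. h \<oplus>\<^bsub>A\<^esub> f = \<zero>\<^bsub>A\<^esub>"
      by (intro bexI[OF _ restrict_mod_in_A])
  qed simp_all
  moreover have "comm_monoid A"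
    by (rule comm_monoidI) (blast intro: assoc one comm A_closed)+
  ultimately show ?thesis
    by (rule cringI) (rule distr)
qed

sublocale A: cring A
  by (rule cring_A)

lemma pairing_minus:
  assumes "f \<in> carrier A"
  shows "[pairing (\<ominus>\<^bsub>A\<^esub> f) w = - pairing f w] (mod int p)"
  using pairing_add[of "\<ominus>\<^bsub>A\<^esub> f" f w] assms
  by (simp add: A.l_neg pairing_zero cong_iff_dvd_diff) (metis dvd_minus_iff minus_add_distrib minus_diff_eq uminus_add_conv_diff add.commute)

lemma pairing_nat_multiple:
  assumes "f \<in> carrier A"
  shows "[pairing ([(k :: nat)] \<cdot>\<^bsub>A\<^esub> f) w = int k * pairing f w] (mod int p)"
proof (induction k)
  case 0
  then show ?case by (simp add: pairing_zero)
next
  case (Suc k)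
  have "[pairing ([Suc k] \<cdot>\<^bsub>A\<^esub> f) w = pairing ([k] \<cdot>\<^bsub>A\<^esub> f) w + pairing f w] (mod int p)"
    using pairing_add[of "[k] \<cdot>\<^bsub>A\<^esub> f" f w] by simp
  also have "[pairing ([k] \<cdot>\<^bsub>A\<^esub> f) w + pairing f w = int k * pairing f w + pairing f w] (mod int p)"
    by (intro cong_add Suc cong_refl)
  finally show ?case by (simp add: algebra_simps)
qed

lemma pairing_multiple:
  assumes f: "f \<in> carrier A"
  shows "[pairing ([(k :: int)] \<cdot>\<^bsub>A\<^esub> f) w = k * pairing f w] (mod int p)"
proof (cases "k \<ge> 0")
  case True
  then show ?thesis
    using pairing_nat_multiple[OF f, of "nat k" w] by (simp add: add_pow_int_ge)
next
  case False
  have "[pairing (\<ominus>\<^bsub>A\<^esub> ([nat (- k)] \<cdot>\<^bsub>A\<^esub> f)) w = - pairing ([nat (- k)] \<cdot>\<^bsub>A\<^esub> f) w] (mod int p)"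
    using f by (intro pairing_minus) simp
  also have "[- pairing ([nat (- k)] \<cdot>\<^bsub>A\<^esub> f) w = - (int (nat (- k)) * pairing f w)] (mod int p)"
    using pairing_nat_multiple[OF f] by (simp only: cong_minus_minus_iff)
  finally show ?thesis
    using False by (simp add: add_pow_int_lt)
qed

lemma multiple_p_eq_zero:
  assumes "f \<in> carrier A"
  shows "[int p] \<cdot>\<^bsub>A\<^esub> f = \<zero>\<^bsub>A\<^esub>"
proof (rule A_eqI)
  fix w show "[pairing ([int p] \<cdot>\<^bsub>A\<^esub> f) w = pairing \<zero>\<^bsub>A\<^esub> w] (mod int p)"
    using pairing_multiple[OF assms, of "int p" w] by (simp add: pairing_zero cong_def)
qed (use assms in simp_all)

lemma multiple_cong:
  assumes "f \<in> carrier A" "[k = l] (mod int p)"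
  shows "[(k :: int)] \<cdot>\<^bsub>A\<^esub> f = [l] \<cdot>\<^bsub>A\<^esub> f"
proof (rule A_eqI)
  fix w
  have "[k * pairing f w = l * pairing f w] (mod int p)"
    using assms by (intro cong_mult cong_refl)
  then show "[pairing ([k] \<cdot>\<^bsub>A\<^esub> f) w = pairing ([l] \<cdot>\<^bsub>A\<^esub> f) w] (mod int p)"
    using pairing_multiple[OF assms(1), of k w] pairing_multiple[OF assms(1), of l w]
    by (simp add: cong_def)
qed (use assms in simp_all)

lemma pairing_finsum:
  assumes "finite S" "f \<in> S \<rightarrow> carrier A"
  shows "[pairing (finsum A f S) w = (\<Sum>s\<in>S. pairing (f s) w)] (mod int p)"
  using assms
proof (induction S rule: finite_induct)
  case empty
  then show ?case by (simp add: pairing_zero)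
next
  case (insert s S)
  then have "[pairing (finsum A f (insert s S)) w = pairing (f s) w + pairing (finsum A f S) w] (mod int p)"
    using pairing_add[of "f s" "finsum A f S" w] by (simp add: Pi_iff)
  also have "[pairing (f s) w + pairing (finsum A f S) w
      = pairing (f s) w + (\<Sum>s\<in>S. pairing (f s) w)] (mod int p)"
    using insert by (intro cong_add cong_refl) auto
  finally show ?case using insert by simp
qed

lemma el_mult:
  assumes "g \<in> carrier G" "h \<in> carrier G"
  shows "el g \<otimes>\<^bsub>A\<^esub> el h = el (g \<otimes> h)"
proof (rule A_eqI)
  fix w show "[pairing (el g \<otimes>\<^bsub>A\<^esub> el h) w = pairing (el (g \<otimes> h)) w] (mod int p)"
    using pairing_mult[of "el g" "el h" w] assms by (simp add: pairing_el)
qed simp_all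

lemma el_expansion:
  assumes f: "f \<in> carrier A"
  shows "f = (\<Oplus>\<^bsub>A\<^esub>g\<in>carrier G. [(f g)] \<cdot>\<^bsub>A\<^esub> el g)"
proof (rule A_eqI)
  fix w
  have "[pairing (\<Oplus>\<^bsub>A\<^esub>g\<in>carrier G. [(f g)] \<cdot>\<^bsub>A\<^esub> el g) w
      = (\<Sum>g\<in>carrier G. pairing ([(f g)] \<cdot>\<^bsub>A\<^esub> el g) w)] (mod int p)"
    using finite_G by (intro pairing_finsum) auto
  also have "[(\<Sum>g\<in>carrier G. pairing ([(f g)] \<cdot>\<^bsub>A\<^esub> el g) w) = (\<Sum>g\<in>carrier G. f g * w g)] (mod int p)"
    by (rule cong_sum, rule cong_trans[OF pairing_multiple]) (simp_all add: pairing_el)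
  finally show "[pairing f w = pairing (\<Oplus>\<^bsub>A\<^esub>g\<in>carrier G. [(f g)] \<cdot>\<^bsub>A\<^esub> el g) w] (mod int p)"
    by (simp add: pairing_def cong_sym)
qed (use f in \<open>auto intro!: A.finsum_closed\<close>)

subsection \<open>Sums over subsets of the group\<close>

definition set_sum :: "'a set \<Rightarrow> 'a \<Rightarrow> int" where
  "set_sum B = (\<Oplus>\<^bsub>A\<^esub>g\<in>B. el g)"

lemma set_sum_closed [simp]: "set_sum B \<in> carrier A"
  by (auto simp: set_sum_def intro: A.finsum_closed)

lemma pairing_set_sum:
  assumes "B \<subseteq> carrier G"
  shows "[pairing (set_sum B) w = (\<Sum>g\<in>B. w g)] (mod int p)"
proof -
  have "[pairing (set_sum B) w = (\<Sum>g\<in>B. pairing (el g) w)] (mod int p)"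
    unfolding set_sum_def using assms finite_G
    by (intro pairing_finsum) (auto intro: finite_subset)
  also have "(\<Sum>g\<in>B. pairing (el g) w) = (\<Sum>g\<in>B. w g)"
    using assms by (intro sum.cong refl) (auto simp: pairing_el)
  finally show ?thesis .
qed

text \<open>
  Instances are complementary subgroups: this is how the norm element of a product of groups becomes
  the product of the norm elements of the factors.
\<close>

lemma set_sum_mult:
  assumes B: "B \<subseteq> carrier G" and C: "C \<subseteq> carrier G"
    and inj: "inj_on (\<lambda>(b, c). b \<otimes> c) (B \<times> C)"
  shows "set_sum B \<otimes>\<^bsub>A\<^esub> set_sum C = set_sum ((\<lambda>(b, c). b \<otimes> c) ` (B \<times> C))"
proof (rule A_eqI)
  fix w
  have BC: "(\<lambda>(b, c). b \<otimes> c) ` (B \<times> C) \<subseteq> carrier G"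
    using B C by auto
  have "[pairing (set_sum B \<otimes>\<^bsub>A\<^esub> set_sum C) w
      = pairing (set_sum B) (\<lambda>y. pairing (set_sum C) (\<lambda>z. w (y \<otimes> z)))] (mod int p)"
    by (intro pairing_mult) simp_all
  also have "[pairing (set_sum B) (\<lambda>y. pairing (set_sum C) (\<lambda>z. w (y \<otimes> z)))
      = (\<Sum>y\<in>B. pairing (set_sum C) (\<lambda>z. w (y \<otimes> z)))] (mod int p)"
    by (rule pairing_set_sum[OF B])
  also have "[(\<Sum>y\<in>B. pairing (set_sum C) (\<lambda>z. w (y \<otimes> z))) = (\<Sum>y\<in>B. \<Sum>z\<in>C. w (y \<otimes> z))] (mod int p)"
    by (intro cong_sum pairing_set_sum[OF C])
  also have "(\<Sum>y\<in>B. \<Sum>z\<in>C. w (y \<otimes> z)) = (\<Sum>g\<in>(\<lambda>(b, c). b \<otimes> c) ` (B \<times> C). w g)"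
    by (subst sum.reindex[OF inj]) (simp add: sum.cartesian_product case_prod_unfold)
  also have "[\<dots> = pairing (set_sum ((\<lambda>(b, c). b \<otimes> c) ` (B \<times> C))) w] (mod int p)"
    by (rule cong_sym[OF pairing_set_sum[OF BC]])
  finally show "[pairing (set_sum B \<otimes>\<^bsub>A\<^esub> set_sum C) w
      = pairing (set_sum ((\<lambda>(b, c). b \<otimes> c) ` (B \<times> C))) w] (mod int p)" .
qed simp_all

lemma norm_element_eq_set_sum: "norm_element F G = set_sum (carrier G)"
  by (simp add: norm_element_def set_sum_def)

abbreviation N where "N \<equiv> norm_element F G"

lemma N_closed [simp]: "N \<in> carrier A"
  by (simp add: norm_element_eq_set_sum)

lemma pairing_N: "[pairing N w = (\<Sum>g\<in>carrier G. w g)] (mod int p)"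
  by (simp add: norm_element_eq_set_sum pairing_set_sum)

definition aug :: "('a \<Rightarrow> int) \<Rightarrow> int" where
  "aug f = pairing f (\<lambda>_. 1)"

text \<open>
  The sum of all group elements is invariant under translation.
\<close>

lemma mult_N:
  assumes f: "f \<in> carrier A"
  shows "f \<otimes>\<^bsub>A\<^esub> N = [(aug f)] \<cdot>\<^bsub>A\<^esub> N"
proof (rule A_eqI)
  fix w :: "'a \<Rightarrow> int"
  let ?s = "\<Sum>g\<in>carrier G. w g"
  have "[pairing (f \<otimes>\<^bsub>A\<^esub> N) w = pairing f (\<lambda>y. pairing N (\<lambda>z. w (y \<otimes> z)))] (mod int p)"
    using f by (intro pairing_mult) simp_all
  also have "[pairing f (\<lambda>y. pairing N (\<lambda>z. w (y \<otimes> z))) = pairing f (\<lambda>_. ?s * 1)] (mod int p)"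
  proof (rule pairing_weight_cong)
    fix y assume "y \<in> carrier G"
    then show "[pairing N (\<lambda>z. w (y \<otimes> z)) = ?s * 1] (mod int p)"
      using pairing_N[of "\<lambda>z. w (y \<otimes> z)"] sum_translate[of y w] by simp
  qed
  also have "pairing f (\<lambda>_. ?s * 1) = aug f * ?s"
    unfolding pairing_weight_scale aug_def by simp
  also have "[aug f * ?s = aug f * pairing N w] (mod int p)"
    by (intro cong_mult cong_refl cong_sym[OF pairing_N])
  also have "[aug f * pairing N w = pairing ([(aug f)] \<cdot>\<^bsub>A\<^esub> N) w] (mod int p)"
    by (intro cong_sym[OF pairing_multiple]) simp
  finally show "[pairing (f \<otimes>\<^bsub>A\<^esub> N) w = pairing ([(aug f)] \<cdot>\<^bsub>A\<^esub> N) w] (mod int p)" .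
qed (use f in simp_all)

lemma Idl_N: "Idl\<^bsub>A\<^esub> {N} = range (\<lambda>k :: int. [k] \<cdot>\<^bsub>A\<^esub> N)"
proof -
  have "Idl\<^bsub>A\<^esub> {N} = {f \<otimes>\<^bsub>A\<^esub> N | f. f \<in> carrier A}"
    using A.cgenideal_eq_genideal[of N] by (simp add: cgenideal_def)
  also have "\<dots> = range (\<lambda>k :: int. [k] \<cdot>\<^bsub>A\<^esub> N)"
  proof (intro equalityI subsetI)
    fix y assume "y \<in> range (\<lambda>k :: int. [k] \<cdot>\<^bsub>A\<^esub> N)"
    then obtain k :: int where "y = [k] \<cdot>\<^bsub>A\<^esub> N" by auto
    then have "y = [k] \<cdot>\<^bsub>A\<^esub> \<one>\<^bsub>A\<^esub> \<otimes>\<^bsub>A\<^esub> N"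
      by (simp add: A.add_pow_ldistr_int)
    then show "y \<in> {f \<otimes>\<^bsub>A\<^esub> N | f. f \<in> carrier A}"
      by auto
  qed (auto simp: mult_N)
  finally show ?thesis .
qed

text \<open>
  An additive character of \<open>G\<close> modulo \<open>p\<close> extends linearly to a derivation from the
  group ring to $\mathbb{F}_p$, viewed as a module through the augmentation.
\<close>

lemma pairing_character_leibniz:
  assumes e: "\<And>y z. y \<in> carrier G \<Longrightarrow> z \<in> carrier G \<Longrightarrow> [e (y \<otimes> z) = e y + e z] (mod int p)"
    and f: "f \<in> carrier A" and h: "h \<in> carrier A"
  shows "[pairing (f \<otimes>\<^bsub>A\<^esub> h) e = pairing f e * aug h + aug f * pairing h e] (mod int p)"
proof -
  have "[pairing (f \<otimes>\<^bsub>A\<^esub> h) e = pairing f (\<lambda>y. pairing h (\<lambda>z. e (y \<otimes> z)))] (mod int p)"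
    using f h by (rule pairing_mult)
  also have "[pairing f (\<lambda>y. pairing h (\<lambda>z. e (y \<otimes> z)))
      = pairing f (\<lambda>y. pairing h (\<lambda>z. e y * 1 + e z))] (mod int p)"
    by (intro pairing_weight_cong) (simp add: e)
  also have "(\<lambda>y. pairing h (\<lambda>z. e y * 1 + e z)) = (\<lambda>y. aug h * e y + pairing h e * 1)"
    unfolding pairing_weight_add pairing_weight_scale aug_def by (simp add: mult.commute)
  also have "pairing f \<dots> = pairing f e * aug h + aug f * pairing h e"
    unfolding pairing_weight_add pairing_weight_scale aug_def by simp
  finally show ?thesis .
qed

end

section \<open>Powers of group elements minus one\<close>

lemma prime_dvd_choose_prime_power:
  fixes p :: nat
  assumes "prime p" "0 < k" "k < p ^ n"
  shows "p dvd (p ^ n choose k)"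
proof (rule ccontr)
  assume "\<not> p dvd (p ^ n choose k)"
  then have "coprime (p ^ n) (p ^ n choose k)"
    using assms(1) by (simp add: prime_imp_coprime)
  moreover have "p ^ n dvd k * (p ^ n choose k)"
    using assms(2) by (simp add: times_binomial_minus1_eq)
  ultimately have "p ^ n dvd k"
    by (simp add: coprime_dvd_mult_left_iff)
  then show False
    using assms by (auto dest: dvd_imp_le)
qed

text \<open>
  Put $q = p^n$. The two binomials $\binom{q-1}{k}$ and $\binom{q-1}{k+1}$ add up to
  $\binom{q}{k+1} \equiv 0$, so the signed binomials are all congruent to the one for $k = q-1$.
\<close>

lemma signed_choose_prime_power_minus_one:
  fixes p :: nat
  assumes p: "prime p" and k: "k \<le> p ^ n - 1"
  shows "[(-1) ^ (p ^ n - 1 + k) * int (p ^ n - 1 choose k) = 1] (mod int p)"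
  using k
proof (induction k rule: inc_induct)
  case base
  then show ?case by simp
next
  case (step k)
  define m where "m = p ^ n - 1"
  have m: "p ^ n = Suc m"
    using prime_gt_0_nat[OF p] by (simp add: m_def)
  have "int p dvd int (Suc m choose Suc k)"
    using prime_dvd_choose_prime_power[OF p, of "Suc k" n] step(2) by (simp flip: m m_def)
  moreover have "(-1) ^ (m + k) * int (m choose k) - (-1) ^ (m + Suc k) * int (m choose Suc k)
      = (-1) ^ (m + k) * int (Suc m choose Suc k)"
    by (simp add: algebra_simps)
  ultimately have "int p dvd (-1) ^ (m + k) * int (m choose k) - (-1) ^ (m + Suc k) * int (m choose Suc k)"
    by (metis dvd_mult)
  then have "[(-1) ^ (m + k) * int (m choose k) = (-1) ^ (m + Suc k) * int (m choose Suc k)] (mod int p)"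
    by (simp add: cong_iff_dvd_diff)
  then show ?case
    using step(3) by (auto simp: m_def intro: cong_trans)
qed

text \<open>
  The induction step in the formula for the \<open>m\<close>-th iterated difference of the sequence \<open>s\<close>.
\<close>

lemma binomial_difference_sum:
  fixes s :: "nat \<Rightarrow> int"
  shows "(\<Sum>k\<le>m. (-1) ^ (m + k) * int (m choose k) * (s (Suc k) - s k))
    = (\<Sum>k\<le>Suc m. (-1) ^ (Suc m + k) * int (Suc m choose k) * s k)"
proof -
  let ?c = "\<lambda>k. (-1) ^ (m + k) * int (m choose k)"
  have "(\<Sum>k\<le>m. ?c k * s k) = (\<Sum>k\<le>Suc m. ?c k * s k)"
    by simp
  also have "\<dots> = ?c 0 * s 0 + (\<Sum>k\<le>m. ?c (Suc k) * s (Suc k))"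
    by (rule sum.atMost_Suc_shift)
  finally have "(\<Sum>k\<le>m. ?c k * (s (Suc k) - s k))
      = - ?c 0 * s 0 + (\<Sum>k\<le>m. (?c k - ?c (Suc k)) * s (Suc k))"
    by (simp add: algebra_simps sum_subtractf sum.distrib sum_negf)
  also have "\<dots> = (\<Sum>k\<le>Suc m. (-1) ^ (Suc m + k) * int (Suc m choose k) * s k)"
    unfolding sum.atMost_Suc_shift[of _ m] by (simp add: algebra_simps)
  finally show ?thesis .
qed

context modular_group_ring
begin

lemma pairing_el_minus_one:
  assumes "g \<in> carrier G"
  shows "[pairing (el g \<ominus>\<^bsub>A\<^esub> \<one>\<^bsub>A\<^esub>) w = w g - w \<one>] (mod int p)"
proof -
  have "[pairing (el g \<ominus>\<^bsub>A\<^esub> \<one>\<^bsub>A\<^esub>) w = pairing (el g) w + pairing (\<ominus>\<^bsub>A\<^esub> \<one>\<^bsub>A\<^esub>) w] (mod int p)"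
    unfolding a_minus_def by (rule pairing_add)
  also have "[pairing (el g) w + pairing (\<ominus>\<^bsub>A\<^esub> \<one>\<^bsub>A\<^esub>) w = w g + - w \<one>] (mod int p)"
    using pairing_minus[of "\<one>\<^bsub>A\<^esub>" w] assms by (intro cong_add) (simp_all add: pairing_el one_A)
  finally show ?thesis by simp
qed

text \<open>
  Multiplication by $g - 1$ is dual to the difference operator $w(\cdot\, g) - w$ on weights.
\<close>

lemma pairing_power:
  assumes g: "g \<in> carrier G"
  shows "[pairing ((el g \<ominus>\<^bsub>A\<^esub> \<one>\<^bsub>A\<^esub>) [^]\<^bsub>A\<^esub> m) w
    = (\<Sum>k\<le>m. (-1) ^ (m + k) * int (m choose k) * w (g [^] k))] (mod int p)"
proof (induction m arbitrary: w)
  case 0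
  then show ?case by (simp add: one_A pairing_el)
next
  case (Suc m)
  let ?x = "el g \<ominus>\<^bsub>A\<^esub> \<one>\<^bsub>A\<^esub>"
  have x: "?x \<in> carrier A" by simp
  have "[pairing (?x [^]\<^bsub>A\<^esub> Suc m) w
      = pairing (?x [^]\<^bsub>A\<^esub> m) (\<lambda>y. pairing ?x (\<lambda>z. w (y \<otimes> z)))] (mod int p)"
    using pairing_mult[of "?x [^]\<^bsub>A\<^esub> m" ?x w] x by simp
  also have "[pairing (?x [^]\<^bsub>A\<^esub> m) (\<lambda>y. pairing ?x (\<lambda>z. w (y \<otimes> z)))
      = pairing (?x [^]\<^bsub>A\<^esub> m) (\<lambda>y. w (y \<otimes> g) - w y)] (mod int p)"
    using pairing_el_minus_one[OF g] by (intro pairing_weight_cong) (metis r_one)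
  also have "[pairing (?x [^]\<^bsub>A\<^esub> m) (\<lambda>y. w (y \<otimes> g) - w y)
      = (\<Sum>k\<le>m. (-1) ^ (m + k) * int (m choose k) * (w (g [^] k \<otimes> g) - w (g [^] k)))] (mod int p)"
    by (rule Suc)
  also have "(\<Sum>k\<le>m. (-1) ^ (m + k) * int (m choose k) * (w (g [^] k \<otimes> g) - w (g [^] k)))
      = (\<Sum>k\<le>Suc m. (-1) ^ (Suc m + k) * int (Suc m choose k) * w (g [^] k))"
    using binomial_difference_sum[of m "\<lambda>k. w (g [^] k)"] by simp
  finally show ?case .
qed

lemma power_eq_set_sum:
  assumes g: "g \<in> carrier G" and inj: "inj_on (\<lambda>k :: nat. g [^] k) {..<p ^ n}"
  shows "(el g \<ominus>\<^bsub>A\<^esub> \<one>\<^bsub>A\<^esub>) [^]\<^bsub>A\<^esub> (p ^ n - 1) = set_sum ((\<lambda>k :: nat. g [^] k) ` {..<p ^ n})"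
proof (rule A_eqI)
  fix w :: "'a \<Rightarrow> int"
  let ?B = "(\<lambda>k :: nat. g [^] k) ` {..<p ^ n}"
  have "Suc (p ^ n - 1) = p ^ n"
    using prime_gt_0_nat[OF prime_p] by simp
  then have *: "{..p ^ n - 1} = {..<p ^ n}"
    by (metis lessThan_Suc_atMost)
  have "[pairing ((el g \<ominus>\<^bsub>A\<^esub> \<one>\<^bsub>A\<^esub>) [^]\<^bsub>A\<^esub> (p ^ n - 1)) w
      = (\<Sum>k\<le>p ^ n - 1. (-1) ^ (p ^ n - 1 + k) * int (p ^ n - 1 choose k) * w (g [^] k))] (mod int p)"
    by (rule pairing_power[OF g])
  also have "[(\<Sum>k\<le>p ^ n - 1. (-1) ^ (p ^ n - 1 + k) * int (p ^ n - 1 choose k) * w (g [^] k))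
      = (\<Sum>k\<le>p ^ n - 1. 1 * w (g [^] k))] (mod int p)"
    by (intro cong_sum cong_mult cong_refl signed_choose_prime_power_minus_one prime_p) simp
  also have "(\<Sum>k\<le>p ^ n - 1. 1 * w (g [^] k)) = (\<Sum>h\<in>?B. w h)"
    by (simp only: sum.reindex[OF inj] * o_def mult_1)
  also have "[(\<Sum>h\<in>?B. w h) = pairing (set_sum ?B) w] (mod int p)"
    using g by (intro cong_sym[OF pairing_set_sum]) auto
  finally show "[pairing ((el g \<ominus>\<^bsub>A\<^esub> \<one>\<^bsub>A\<^esub>) [^]\<^bsub>A\<^esub> (p ^ n - 1)) w = pairing (set_sum ?B) w] (mod int p)" .
qed simp_all

end

section \<open>Products of cyclic p-groups\<close>

locale cyclic_product =
  fixes p r :: nat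
    and n :: "nat \<Rightarrow> nat"
    and C :: "nat \<Rightarrow> ('c, 'm) monoid_scheme"
    and c :: "nat \<Rightarrow> 'c"
    and G :: "(nat \<Rightarrow> 'c) monoid" (structure)
    and g :: "nat \<Rightarrow> (nat \<Rightarrow> 'c)"
  assumes p: "prime p"
    and n: "\<And>i. i \<in> {1..r} \<Longrightarrow> n i \<ge> 1"
    and group_C: "\<And>i. i \<in> {1..r} \<Longrightarrow> group (C i)"
    and order_C: "\<And>i. i \<in> {1..r} \<Longrightarrow> order (C i) = p ^ n i"
    and c: "\<And>i. i \<in> {1..r} \<Longrightarrow> c i \<in> carrier (C i)"
    and generate_c: "\<And>i. i \<in> {1..r} \<Longrightarrow> generate (C i) {c i} = carrier (C i)"
    and G_eq: "G = product_group {1..r} C"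
    and g_eq: "\<And>i. i \<in> {1..r} \<Longrightarrow> g i = (\<lambda>j\<in>{1..r}. if j = i then c j else \<one>\<^bsub>C j\<^esub>)"
begin

abbreviation q where "q i \<equiv> p ^ n i"

lemma ord_c: "i \<in> {1..r} \<Longrightarrow> group.ord (C i) (c i) = q i"
  using group.generate_pow_card[OF group_C c, of i] generate_c[of i] order_C[of i]
  by (simp add: order_def)

lemma finite_C: "i \<in> {1..r} \<Longrightarrow> finite (carrier (C i))"
  using order_C[of i] prime_gt_0_nat[OF p] by (intro card_ge_0_finite) (simp add: order_def)

lemma inj_power_c:
  assumes i: "i \<in> {1..r}"
  shows "inj_on (\<lambda>k :: nat. c i [^]\<^bsub>C i\<^esub> k) {..<q i}"
proof -
  have "Suc (q i - 1) = q i"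
    using prime_gt_0_nat[OF p] by simp
  then have "{..<q i} = {0..q i - 1}"
    by (metis lessThan_Suc_atMost atLeast0AtMost)
  then show ?thesis
    using group.ord_inj[OF group_C[OF i] c[OF i]] ord_c[OF i] by simp
qed

lemma carrier_C:
  assumes i: "i \<in> {1..r}"
  shows "(\<lambda>k :: nat. c i [^]\<^bsub>C i\<^esub> k) ` {..<q i} = carrier (C i)"
proof (rule card_subset_eq[OF finite_C[OF i]])
  interpret Ci: group "C i" by (rule group_C[OF i])
  show "(\<lambda>k :: nat. c i [^]\<^bsub>C i\<^esub> k) ` {..<q i} \<subseteq> carrier (C i)"
    using c[OF i] by auto
  show "card ((\<lambda>k :: nat. c i [^]\<^bsub>C i\<^esub> k) ` {..<q i}) = card (carrier (C i))"
    using card_image[OF inj_power_c[OF i]] order_C[OF i] by (simp add: order_def)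
qed

lemma power_c_eq_cong:
  assumes i: "i \<in> {1..r}" and eq: "c i [^]\<^bsub>C i\<^esub> (k :: nat) = c i [^]\<^bsub>C i\<^esub> (l :: nat)"
  shows "[int k = int l] (mod int p)"
proof -
  interpret Ci: group "C i" by (rule group_C[OF i])
  have "c i [^]\<^bsub>C i\<^esub> int l = c i [^]\<^bsub>C i\<^esub> int k"
    using eq by (simp add: int_pow_int)
  then have "int (q i) dvd int k - int l"
    using Ci.int_pow_eq[OF c[OF i]] ord_c[OF i] by simp
  moreover have "int p dvd int (q i)"
    using n[OF i] by (simp add: dvd_power)
  ultimately show ?thesis
    by (auto simp: cong_iff_dvd_diff intro: dvd_trans)
qed

lemma carrier_G: "carrier G = (\<Pi>\<^sub>E i\<in>{1..r}. carrier (C i))"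
  by (simp add: G_eq)

lemma mult_coord: "i \<in> {1..r} \<Longrightarrow> (a \<otimes> b) i = a i \<otimes>\<^bsub>C i\<^esub> b i"
  by (simp add: G_eq)

lemma one_coord: "i \<in> {1..r} \<Longrightarrow> \<one> i = \<one>\<^bsub>C i\<^esub>"
  by (simp add: G_eq)

lemma coord_closed: "a \<in> carrier G \<Longrightarrow> i \<in> {1..r} \<Longrightarrow> a i \<in> carrier (C i)"
  by (auto simp: carrier_G)

lemma coord_eqI:
  assumes "a \<in> carrier G" "b \<in> carrier G" "\<And>i. i \<in> {1..r} \<Longrightarrow> a i = b i"
  shows "a = b"
  using assms unfolding carrier_G by (intro PiE_ext)

sublocale modular_group_ring G p
proof -
  interpret G: group G
    unfolding G_eq by (rule product_group) (rule group_C)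
  have "comm_group G"
  proof (rule G.group_comm_groupI)
    fix a b assume ab: "a \<in> carrier G" "b \<in> carrier G"
    show "a \<otimes> b = b \<otimes> a"
    proof (rule coord_eqI)
      fix i assume i: "i \<in> {1..r}"
      interpret Ci: group "C i" by (rule group_C[OF i])
      obtain k l :: nat where "a i = c i [^]\<^bsub>C i\<^esub> k" "b i = c i [^]\<^bsub>C i\<^esub> l"
        using coord_closed[OF ab(1) i] coord_closed[OF ab(2) i] carrier_C[OF i] by blast
      then show "(a \<otimes> b) i = (b \<otimes> a) i"
        using c[OF i] by (simp add: mult_coord[OF i] Ci.nat_pow_mult add.commute)
    qed (use ab in auto)
  qed
  moreover have "finite (carrier G)"
    unfolding carrier_G by (intro finite_PiE finite_C) auto
  ultimately show "modular_group_ring G p"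
    using p by (intro modular_group_ring.intro modular_group_ring_axioms.intro)
qed

lemma g_closed [simp]: "i \<in> {1..r} \<Longrightarrow> g i \<in> carrier G"
  using c group.is_monoid[OF group_C] by (auto simp: g_eq carrier_G monoid.one_closed)

lemma g_pow_coord:
  assumes i: "i \<in> {1..r}" and j: "j \<in> {1..r}"
  shows "(g j [^] (k :: nat)) i = (if i = j then c j [^]\<^bsub>C j\<^esub> k else \<one>\<^bsub>C i\<^esub>)"
proof -
  interpret Ci: group "C i" by (rule group_C[OF i])
  show ?thesis
    by (induction k) (use i j c in \<open>auto simp: mult_coord one_coord g_eq\<close>)
qed

lemma inj_power_g:
  assumes j: "j \<in> {1..r}"
  shows "inj_on (\<lambda>k :: nat. g j [^] k) {..<q j}"
proof (rule inj_onI)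
  fix k l :: nat assume kl: "k \<in> {..<q j}" "l \<in> {..<q j}" "g j [^] k = g j [^] l"
  then have "(g j [^] k) j = (g j [^] l) j" by simp
  then show "k = l"
    using inj_onD[OF inj_power_c[OF j] _ kl(1,2)] j by (simp add: g_pow_coord)
qed

text \<open>
  The exponent of $g_i$ in \<open>h\<close>. Modulo \<open>p\<close> it is additive in \<open>h\<close>, as $c_i$ has order
  divisible by \<open>p\<close>; here $n_i \ge 1$ is essential.
\<close>

definition dlog :: "nat \<Rightarrow> (nat \<Rightarrow> 'c) \<Rightarrow> nat" where
  "dlog i h = inv_into {..<q i} (\<lambda>k. c i [^]\<^bsub>C i\<^esub> k) (h i)"

lemma power_dlog:
  assumes "h \<in> carrier G" "i \<in> {1..r}"
  shows "c i [^]\<^bsub>C i\<^esub> dlog i h = h i" "dlog i h < q i"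
proof -
  have *: "h i \<in> (\<lambda>k. c i [^]\<^bsub>C i\<^esub> k) ` {..<q i}"
    using coord_closed[OF assms] carrier_C[OF assms(2)] by simp
  show "c i [^]\<^bsub>C i\<^esub> dlog i h = h i"
    unfolding dlog_def by (rule f_inv_into_f[OF *])
  show "dlog i h < q i"
    using inv_into_into[OF *] unfolding dlog_def by simp
qed

lemma dlog_mult:
  assumes h: "h \<in> carrier G" and h': "h' \<in> carrier G" and i: "i \<in> {1..r}"
  shows "[int (dlog i (h \<otimes> h')) = int (dlog i h) + int (dlog i h')] (mod int p)"
proof -
  interpret Ci: group "C i" by (rule group_C[OF i])
  have "c i [^]\<^bsub>C i\<^esub> dlog i (h \<otimes> h') = c i [^]\<^bsub>C i\<^esub> (dlog i h + dlog i h')"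
    using power_dlog[OF h i] power_dlog[OF h' i] power_dlog[of "h \<otimes> h'" i] h h' i c[OF i]
    by (simp add: mult_coord Ci.nat_pow_mult[symmetric])
  from power_c_eq_cong[OF i this] show ?thesis by simp
qed

lemma dlog_g:
  assumes i: "i \<in> {1..r}" and j: "j \<in> {1..r}"
  shows "[int (dlog j (g i)) = (if i = j then 1 else 0)] (mod int p)"
proof -
  interpret Cj: group "C j" by (rule group_C[OF j])
  have "c j [^]\<^bsub>C j\<^esub> dlog j (g i) = c j [^]\<^bsub>C j\<^esub> (if i = j then 1 else 0 :: nat)"
    using power_dlog[OF g_closed[OF i] j] i j c[OF j] by (cases "i = j") (simp_all add: g_eq)
  from power_c_eq_cong[OF j this] show ?thesis by (simp split: if_splits)
qed

text \<open>
  The subgroup generated by the $g_i$ with $i \in T$. Adding the indices one at a time reduces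
  statements about \<open>G\<close> to cyclic groups.
\<close>

definition partial_product :: "nat set \<Rightarrow> (nat \<Rightarrow> 'c) set" where
  "partial_product T = {h \<in> carrier G. \<forall>i\<in>{1..r} - T. h i = \<one>\<^bsub>C i\<^esub>}"

lemma partial_product_subset: "partial_product T \<subseteq> carrier G"
  by (auto simp: partial_product_def)

lemma partial_product_empty: "partial_product {} = {\<one>}"
  by (auto simp: partial_product_def one_coord intro!: coord_eqI)

lemma partial_product_full: "partial_product {1..r} = carrier G"
  by (auto simp: partial_product_def)

abbreviation g_powers where "g_powers j \<equiv> (\<lambda>k :: nat. g j [^] k) ` {..<q j}"

lemma inj_partial_product_mult:
  assumes j: "j \<in> {1..r}" "j \<notin> T"
  shows "inj_on (\<lambda>(b, y). b \<otimes> y) (partial_product T \<times> g_powers j)"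
proof (rule inj_onI, clarsimp)
  interpret Cj: group "C j" by (rule group_C[OF j(1)])
  fix b b' and k k' :: nat
  assume b: "b \<in> partial_product T" "b' \<in> partial_product T" and k: "k < q j" "k' < q j"
    and eq: "b \<otimes> g j [^] k = b' \<otimes> g j [^] k'"
  have "b j = \<one>\<^bsub>C j\<^esub>" "b' j = \<one>\<^bsub>C j\<^esub>"
    using b j by (auto simp: partial_product_def)
  moreover have "(b \<otimes> g j [^] k) j = (b' \<otimes> g j [^] k') j"
    using eq by simp
  ultimately have "c j [^]\<^bsub>C j\<^esub> k = c j [^]\<^bsub>C j\<^esub> k'"
    using j c by (simp add: mult_coord g_pow_coord)
  then have "k = k'"
    using inj_onD[OF inj_power_c[OF j(1)], of k k'] k by simp
  then show "b = b' \<and> g j [^] k = g j [^] k'"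
    using eq b partial_product_subset j by (simp add: subset_iff)
qed

lemma partial_product_insert:
  assumes j: "j \<in> {1..r}" "j \<notin> T"
  shows "(\<lambda>(b, y). b \<otimes> y) ` (partial_product T \<times> g_powers j) = partial_product (insert j T)"
proof (intro equalityI subsetI)
  fix h assume "h \<in> (\<lambda>(b, y). b \<otimes> y) ` (partial_product T \<times> g_powers j)"
  then obtain b and k :: nat where bk: "b \<in> partial_product T" "h = b \<otimes> g j [^] k" by auto
  have b: "b \<in> carrier G" "\<And>i. i \<in> {1..r} - T \<Longrightarrow> b i = \<one>\<^bsub>C i\<^esub>"
    using bk by (auto simp: partial_product_def)
  have "h i = \<one>\<^bsub>C i\<^esub>" if i: "i \<in> {1..r} - insert j T" for i
  proof -
    interpret Ci: group "C i" using i by (intro group_C) auto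
    show ?thesis
      using i b(2)[of i] j by (simp add: bk(2) mult_coord g_pow_coord)
  qed
  then show "h \<in> partial_product (insert j T)"
    using b j by (auto simp: partial_product_def bk(2))
next
  fix h assume "h \<in> partial_product (insert j T)"
  then have h: "h \<in> carrier G" "\<And>i. i \<in> {1..r} - insert j T \<Longrightarrow> h i = \<one>\<^bsub>C i\<^esub>"
    by (auto simp: partial_product_def)
  define b where "b = (\<lambda>i\<in>{1..r}. if i = j then \<one>\<^bsub>C i\<^esub> else h i)"
  have b: "b \<in> carrier G"
    using h group.is_monoid[OF group_C] by (auto simp: b_def carrier_G monoid.one_closed PiE_iff)
  have "b \<in> partial_product T"
    using b h by (auto simp: partial_product_def b_def)
  moreover have "h = b \<otimes> g j [^] dlog j h"
  proof (rule coord_eqI)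
    fix i assume i: "i \<in> {1..r}"
    interpret Ci: group "C i" by (rule group_C[OF i])
    interpret Cj: group "C j" by (rule group_C[OF j(1)])
    show "h i = (b \<otimes> g j [^] dlog j h) i"
      using i j coord_closed[OF h(1) i] power_dlog[OF h(1) j(1)]
      by (cases "i = j") (simp_all add: mult_coord g_pow_coord b_def)
  qed (use h b j in auto)
  moreover have "g j [^] dlog j h \<in> g_powers j"
    using power_dlog[OF h(1) j(1)] by simp
  ultimately show "h \<in> (\<lambda>(b, y). b \<otimes> y) ` (partial_product T \<times> g_powers j)"
    by force
qed

abbreviation x where "x i \<equiv> el (g i) \<ominus>\<^bsub>A\<^esub> \<one>\<^bsub>A\<^esub>"

lemma x_closed [simp]: "x i \<in> carrier A"
  by simp

lemma finprod_x_powers: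
  assumes "finite T" "T \<subseteq> {1..r}"
  shows "(\<Otimes>\<^bsub>A\<^esub>j\<in>T. x j [^]\<^bsub>A\<^esub> (q j - 1)) = set_sum (partial_product T)"
  using assms
proof (induction T rule: finite_induct)
  case empty
  have "set_sum {\<one>} = \<one>\<^bsub>A\<^esub>"
    by (simp add: set_sum_def one_A)
  then show ?case by (simp add: partial_product_empty)
next
  case (insert j T)
  have j: "j \<in> {1..r}" "j \<notin> T" using insert by auto
  have gp: "g_powers j \<subseteq> carrier G" using j by auto
  have "(\<Otimes>\<^bsub>A\<^esub>j\<in>insert j T. x j [^]\<^bsub>A\<^esub> (q j - 1))
      = x j [^]\<^bsub>A\<^esub> (q j - 1) \<otimes>\<^bsub>A\<^esub> (\<Otimes>\<^bsub>A\<^esub>j\<in>T. x j [^]\<^bsub>A\<^esub> (q j - 1))"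
    using insert by (intro A.finprod_insert) auto
  also have "\<dots> = set_sum (g_powers j) \<otimes>\<^bsub>A\<^esub> set_sum (partial_product T)"
    using insert power_eq_set_sum[OF g_closed[OF j(1)] inj_power_g[OF j(1)]] by simp
  also have "\<dots> = set_sum (partial_product T) \<otimes>\<^bsub>A\<^esub> set_sum (g_powers j)"
    by (rule A.m_comm) simp_all
  also have "\<dots> = set_sum (partial_product (insert j T))"
    using set_sum_mult[OF partial_product_subset gp inj_partial_product_mult[OF j]] by (simp add: partial_product_insert[OF j])
  finally show ?case .
qed

lemma norm_element_factorisation: "N = (\<Otimes>\<^bsub>A\<^esub>j\<in>{1..r}. x j [^]\<^bsub>A\<^esub> (q j - 1))"
  by (simp only: finprod_x_powers[OF finite_atLeastAtMost subset_refl] partial_product_full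
      norm_element_eq_set_sum)


lemma order_G: "order G = (\<Prod>i\<in>{1..r}. q i)"
  using order_C by (simp add: order_def carrier_G card_PiE)

lemma aug_el: "h \<in> carrier G \<Longrightarrow> aug (el h) = 1"
  by (simp add: aug_def pairing_el)

lemma x_mult_N:
  assumes "i \<in> {1..r}"
  shows "x i \<otimes>\<^bsub>A\<^esub> N = \<zero>\<^bsub>A\<^esub>"
proof -
  have "[aug (x i) = 0] (mod int p)"
    using pairing_el_minus_one[OF g_closed[OF assms], of "\<lambda>_. 1"] by (simp add: aug_def)
  then show ?thesis
    using multiple_cong[OF N_closed, of "aug (x i)" 0] by (simp add: mult_N add_pow_def)
qed

lemma multiple_of_annihilator:
  assumes "a \<in> carrier A" "y \<in> carrier A" "y \<otimes>\<^bsub>A\<^esub> N = \<zero>\<^bsub>A\<^esub>"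
  shows "(a \<otimes>\<^bsub>A\<^esub> y) \<otimes>\<^bsub>A\<^esub> N = \<zero>\<^bsub>A\<^esub>"
  using assms by (simp add: A.m_assoc)

lemma x_power_mult_N:
  fixes m :: nat
  assumes "i \<in> {1..r}" "m > 0"
  shows "x i [^]\<^bsub>A\<^esub> m \<otimes>\<^bsub>A\<^esub> N = \<zero>\<^bsub>A\<^esub>"
proof -
  obtain k where "m = Suc k"
    using assms(2) by (cases m) auto
  then show ?thesis
    using multiple_of_annihilator[of "x i [^]\<^bsub>A\<^esub> k" "x i"] x_mult_N[OF assms(1)] by simp
qed

text \<open>
  Split off one factor $x_1$ from $N = \prod_j x_j^{q_j - 1}$, where $q_j = p^{n_j}$. What remains
  still contains some $x_i$ unless $r = 1$ and $q_1 = 2$, that is, unless $|G| = 2$. Every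
  multiple of an $x_i$ annihilates $N$.
\<close>

lemma norm_element_decomposable:
  assumes "order G > 2"
  obtains u v where "u \<in> carrier A" "v \<in> carrier A" "N = u \<otimes>\<^bsub>A\<^esub> v"
    "u \<otimes>\<^bsub>A\<^esub> N = \<zero>\<^bsub>A\<^esub>" "v \<otimes>\<^bsub>A\<^esub> N = \<zero>\<^bsub>A\<^esub>"
proof -
  let ?P = "\<lambda>T. \<Otimes>\<^bsub>A\<^esub>j\<in>T. x j [^]\<^bsub>A\<^esub> (q j - 1)"
  have P: "?P T \<in> carrier A" for T
    by (intro A.finprod_closed) auto
  have split: "?P T = x j [^]\<^bsub>A\<^esub> (q j - 1) \<otimes>\<^bsub>A\<^esub> ?P (T - {j})" if "j \<in> T" "finite T" for j T
  proof -
    have "?P (insert j (T - {j})) = x j [^]\<^bsub>A\<^esub> (q j - 1) \<otimes>\<^bsub>A\<^esub> ?P (T - {j})"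
      using that by (intro A.finprod_insert) auto
    then show ?thesis
      using that by (simp add: insert_absorb)
  qed
  have q: "q i > 1" if "i \<in> {1..r}" for i
    using n[OF that] prime_gt_1_nat[OF p] by (intro one_less_power) auto
  have r: "1 \<in> {1..r}"
    using assms by (cases r) (simp_all add: order_G)
  define v where "v = x 1 [^]\<^bsub>A\<^esub> (q 1 - 2) \<otimes>\<^bsub>A\<^esub> ?P ({1..r} - {1})"
  have v: "v \<in> carrier A"
    using P by (simp add: v_def)
  have "Suc (q 1 - 2) = q 1 - 1"
    using q[OF r] by simp
  then have "x 1 [^]\<^bsub>A\<^esub> (q 1 - 1) = x 1 \<otimes>\<^bsub>A\<^esub> x 1 [^]\<^bsub>A\<^esub> (q 1 - 2)"
    by (metis A.nat_pow_Suc2 x_closed)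
  then have "N = x 1 \<otimes>\<^bsub>A\<^esub> v"
    using split[OF r] P by (simp add: norm_element_factorisation v_def A.m_assoc)
  moreover have "v \<otimes>\<^bsub>A\<^esub> N = \<zero>\<^bsub>A\<^esub>"
  proof (cases "r = 1")
    case True
    then have "q 1 - 2 > 0"
      using assms by (simp add: order_G)
    then have "x 1 [^]\<^bsub>A\<^esub> (q 1 - 2) \<otimes>\<^bsub>A\<^esub> N = \<zero>\<^bsub>A\<^esub>"
      by (rule x_power_mult_N[OF r])
    then show ?thesis
      using multiple_of_annihilator[OF P[of "{1..r} - {1}"], of "x 1 [^]\<^bsub>A\<^esub> (q 1 - 2)"] P[of "{1..r} - {1}"]
      by (simp add: v_def A.m_comm)
  next
    case False
    then have 2: "2 \<in> {1..r} - {1}" "2 \<in> {1..r}"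
      using r by auto
    have "x 2 [^]\<^bsub>A\<^esub> (q 2 - 1) \<otimes>\<^bsub>A\<^esub> N = \<zero>\<^bsub>A\<^esub>"
      using q[OF 2(2)] by (intro x_power_mult_N[OF 2(2)]) simp
    then have "(?P ({1..r} - {1} - {2}) \<otimes>\<^bsub>A\<^esub> x 2 [^]\<^bsub>A\<^esub> (q 2 - 1)) \<otimes>\<^bsub>A\<^esub> N = \<zero>\<^bsub>A\<^esub>"
      by (intro multiple_of_annihilator P) simp_all
    moreover have "?P ({1..r} - {1}) = ?P ({1..r} - {1} - {2}) \<otimes>\<^bsub>A\<^esub> x 2 [^]\<^bsub>A\<^esub> (q 2 - 1)"
      unfolding split[OF 2(1) finite_Diff[OF finite_atLeastAtMost]] by (intro A.m_comm P) simp
    ultimately show ?thesis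
      unfolding v_def by (intro multiple_of_annihilator P) simp_all
  qed
  ultimately show ?thesis
    using that[of "x 1" v] v x_mult_N[OF r] by simp
qed

section \<open>Symbols over the norm ideal\<close>

abbreviation I where "I \<equiv> Idl\<^bsub>A\<^esub> {N}"

lemma socle_line_exists:
  assumes "order G > 2"
  obtains u v where "socle_line I A p N u v aug (\<lambda>f. f \<one>)"
proof -
  obtain u v where uv: "u \<in> carrier A" "v \<in> carrier A" "N = u \<otimes>\<^bsub>A\<^esub> v"
    "u \<otimes>\<^bsub>A\<^esub> N = \<zero>\<^bsub>A\<^esub>" "v \<otimes>\<^bsub>A\<^esub> N = \<zero>\<^bsub>A\<^esub>"
    using norm_element_decomposable[OF assms] by blast
  have "ideal I A"
    by (rule A.genideal_ideal) simp
  then have ideal: "cring_ideal I A"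
    by (intro cring_ideal.intro cring_A)
  have coordinate: "[([(k :: int)] \<cdot>\<^bsub>A\<^esub> N) \<one> = k] (mod int p)" for k
  proof -
    let ?w = "\<lambda>y. if y = \<one> then 1 else 0 :: int"
    have "pairing f ?w = f \<one>" for f
      using finite_G by (simp add: pairing_def if_distrib cong: if_cong)
    moreover have "[pairing N ?w = 1] (mod int p)"
      using pairing_N[of ?w] finite_G by simp
    then have "[k * pairing N ?w = k * 1] (mod int p)"
      by (intro cong_mult cong_refl)
    ultimately show ?thesis
      using pairing_multiple[OF N_closed, of k ?w] by (auto intro: cong_trans)
  qed
  have "socle_line I A p N u v aug (\<lambda>f. f \<one>)"
    by (intro socle_line.intro socle_line_axioms.intro)
      (fact ideal coordinate uv Idl_N N_closed | simp add: mult_N multiple_p_eq_zero)+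
  then show ?thesis by (rule that)
qed

lemma K2_rel_norm_ideal:
  assumes "order G > 2"
    and b: "\<And>i. i \<in> {1..r} \<Longrightarrow> b i = ds_symbol A I (x i) N"
  shows "elementary_abelian_group p (K2_rel A I)
    \<and> vectorspace F (power_module (K2_rel A I))
    \<and> vectorspace.dim F (power_module (K2_rel A I)) = r
    \<and> inj_on b {1..r}
    \<and> vectorspace.basis F (power_module (K2_rel A I)) (b ` {1..r})"
proof -
  obtain u v where "socle_line I A p N u v aug (\<lambda>f. f \<one>)"
    using socle_line_exists[OF assms(1)] by blast
  then interpret S: socle_line I A p N u v aug "\<lambda>f. f \<one>" .
  let ?K = "K2_rel A I"
  have "\<exists>\<phi>. (\<forall>X\<in>carrier ?K. \<forall>Y\<in>carrier ?K. [\<phi> (X \<otimes>\<^bsub>?K\<^esub> Y) = \<phi> X + \<phi> Y] (mod int p)) \<and>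
      (\<forall>i\<in>{1..r}. [\<phi> (b i) = (if i = j then 1 else 0)] (mod int p))"
    if j: "j \<in> {1..r}" for j
  proof -
    let ?e = "\<lambda>h. int (dlog j h)"
    \<comment> \<open>The derivation that sends a group element to its exponent of $g_j$.\<close>
    obtain \<phi> where \<phi>: "\<And>X Y. X \<in> carrier ?K \<Longrightarrow> Y \<in> carrier ?K \<Longrightarrow>
        [\<phi> (X \<otimes>\<^bsub>?K\<^esub> Y) = \<phi> X + \<phi> Y] (mod int p)"
      "\<And>a. a \<in> carrier A \<Longrightarrow> [\<phi> (S.D a) = pairing a ?e] (mod int p)"
      using S.K2_rel_functional_of_derivation[of "\<lambda>f. pairing f ?e",
          OF pairing_add pairing_character_leibniz[OF dlog_mult]] j by blast
    have "[\<phi> (b i) = (if i = j then 1 else 0)] (mod int p)" if i: "i \<in> {1..r}" for i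
    proof -
      have "[int (dlog j \<one>) = 0] (mod int p)"
        using dlog_mult[of \<one> \<one> j] j by (simp add: cong_iff_dvd_diff)
      then have "[int (dlog j (g i)) - int (dlog j \<one>) = (if i = j then 1 else 0) - 0] (mod int p)"
        by (intro cong_diff dlog_g i j)
      then have "[pairing (x i) ?e = (if i = j then 1 else 0)] (mod int p)"
        using pairing_el_minus_one[OF g_closed[OF i], of ?e] by (auto intro: cong_trans)
      then show ?thesis
        using \<phi>(2)[of "x i"] b[OF i] by (auto intro: cong_trans)
    qed
    then show ?thesis using \<phi>(1) by blast
  qed
  then obtain \<phi> where \<phi>: "\<And>j X Y. j \<in> {1..r} \<Longrightarrow> X \<in> carrier ?K \<Longrightarrow> Y \<in> carrier ?K \<Longrightarrow>
      [\<phi> j (X \<otimes>\<^bsub>?K\<^esub> Y) = \<phi> j X + \<phi> j Y] (mod int p)"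
    "\<And>i j. i \<in> {1..r} \<Longrightarrow> j \<in> {1..r} \<Longrightarrow> [\<phi> j (b i) = (if i = j then 1 else 0)] (mod int p)"
    by metis
  have gen: "carrier ?K \<subseteq> H" if H: "subgroup H ?K" and bH: "b ` {1..r} \<subseteq> H" for H
  proof (rule S.K2_rel_generated_by_D[OF H])
    \<comment> \<open>Group elements have augmentation one, so \<open>D\<close> is multiplicative on them.\<close>
    have mult: "S.D (el (h \<otimes> h')) \<in> H"
      if "h \<in> carrier G" "h' \<in> carrier G" "S.D (el h) \<in> H" "S.D (el h') \<in> H" for h h'
      using that S.D_mult[of "el h" "el h'"] subgroup.m_closed[OF H]
      by (simp add: el_mult aug_el)
    have one: "S.D (el \<one>) \<in> H"
      using S.D_one subgroup.one_closed[OF H] by (simp add: one_A)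
    have "S.D (el (g j)) \<in> H" if j: "j \<in> {1..r}" for j
    proof -
      have "el (g j) = x j \<oplus>\<^bsub>A\<^esub> \<one>\<^bsub>A\<^esub>"
        by (simp add: a_minus_def A.a_assoc A.l_neg)
      then have "S.D (el (g j)) = b j"
        using S.D_add[of "x j" "\<one>\<^bsub>A\<^esub>"] S.D_one b[OF j] by simp
      then show ?thesis
        using bH j by auto
    qed
    then have pow: "S.D (el (g j [^] (k :: nat))) \<in> H" if "j \<in> {1..r}" for j k
      using that by (induction k) (auto intro: one mult)
    have "S.D (el h) \<in> H" if "finite T" "T \<subseteq> {1..r}" "h \<in> partial_product T" for T h
      using that
    proof (induction T arbitrary: h rule: finite_induct)
      case empty
      then show ?case using one by (simp add: partial_product_empty)
    next
      case (insert j T)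
      then have "h \<in> (\<lambda>(b, y). b \<otimes> y) ` (partial_product T \<times> g_powers j)"
        using partial_product_insert[of j T] by simp
      then obtain b' k where "b' \<in> partial_product T" "h = b' \<otimes> g j [^] (k :: nat)"
        by auto
      then show ?case
        using insert pow[of j k] partial_product_subset[of T] by (auto intro!: mult)
    qed
    from this[of "{1..r}"] have el: "S.D (el h) \<in> H" if "h \<in> carrier G" for h
      using that partial_product_full by simp
    fix f assume f: "f \<in> carrier A"
    have "S.D (\<Oplus>\<^bsub>A\<^esub>h\<in>carrier G. [(f h)] \<cdot>\<^bsub>A\<^esub> el h) \<in> H"
      using finite_G
      by (intro S.D_finsum_mem[OF H]) (auto simp: S.D_multiple intro!: S.K.subgroup_int_pow_closed[OF H] el)
    then show "S.D f \<in> H"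
      using el_expansion[OF f] by simp
  qed
  have bK: "b i \<in> carrier ?K" if "i \<in> {1..r}" for i
    using b[OF that] by simp
  show ?thesis
    using S.elementary_abelian_K2_rel vectorspace_power_module[OF p S.elementary_abelian_K2_rel]
      basis_by_dual_functionals[OF p S.elementary_abelian_K2_rel bK gen \<phi>]
    by blast
qed

end

theorem lemma3p1:
  fixes p r :: nat
    and n :: "nat \<Rightarrow> nat"
    and C :: "nat \<Rightarrow> ('c, 'm) monoid_scheme"
    and c :: "nat \<Rightarrow> 'c"
    and G :: "(nat \<Rightarrow> 'c) monoid"
    and g :: "nat \<Rightarrow> (nat \<Rightarrow> 'c)"
    and F :: "int ring"
    and A :: "((nat \<Rightarrow> 'c) \<Rightarrow> int) ring"
    and I :: "((nat \<Rightarrow> 'c) \<Rightarrow> int) set"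
    and x :: "nat \<Rightarrow> ((nat \<Rightarrow> 'c) \<Rightarrow> int)"
    and b :: "nat \<Rightarrow> ((((nat \<Rightarrow> 'c) \<Rightarrow> int) \<times> ((nat \<Rightarrow> 'c) \<Rightarrow> int)) \<Rightarrow>\<^sub>0 int) set"
  assumes "prime p"
    and "\<And>i. i \<in> {1..r} \<Longrightarrow> n i \<ge> 1"
    and "\<And>i. i \<in> {1..r} \<Longrightarrow> group (C i)"
    and "\<And>i. i \<in> {1..r} \<Longrightarrow> order (C i) = p ^ n i"
    and "\<And>i. i \<in> {1..r} \<Longrightarrow> c i \<in> carrier (C i)"
    and "\<And>i. i \<in> {1..r} \<Longrightarrow> generate (C i) {c i} = carrier (C i)"
    and G: "G = product_group {1..r} C"
    and g: "\<And>i. i \<in> {1..r} \<Longrightarrow> g i = (\<lambda>j\<in>{1..r}. if j = i then c j else \<one>\<^bsub>C j\<^esub>)"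
    and "order G > 2"
    and F: "F = residue_ring (int p)"
    and A: "A = group_ring F G"
    and I: "I = Idl\<^bsub>A\<^esub> {norm_element F G}"
    and x: "\<And>i. i \<in> {1..r} \<Longrightarrow> x i = group_ring_of F G (g i) \<ominus>\<^bsub>A\<^esub> \<one>\<^bsub>A\<^esub>"
    and b: "\<And>i. i \<in> {1..r} \<Longrightarrow>
          b i = ds_symbol A I (x i) (\<Otimes>\<^bsub>A\<^esub>j\<in>{1..r}. x j [^]\<^bsub>A\<^esub> (p ^ n j - 1))"
  shows "elementary_abelian_group p (K2_rel A I)
    \<and> vectorspace F (power_module (K2_rel A I))
    \<and> vectorspace.dim F (power_module (K2_rel A I)) = r
    \<and> inj_on b {1..r}
    \<and> vectorspace.basis F (power_module (K2_rel A I)) (b ` {1..r})"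
proof -
  interpret L: cyclic_product p r n C c G g
    using assms(1-8) by (rule cyclic_product.intro)
  have A': "A = L.A" and I': "I = L.I"
    by (simp_all add: A I F)
  have x': "x i = L.x i" if "i \<in> {1..r}" for i
    using x[OF that] by (simp add: A F)
  have "(\<Otimes>\<^bsub>L.A\<^esub>j\<in>{1..r}. x j [^]\<^bsub>L.A\<^esub> (p ^ n j - 1)) = L.N"
    unfolding L.norm_element_factorisation
    by (rule L.A.finprod_cong') (simp_all only: x', simp)
  then have "b i = ds_symbol L.A L.I (L.x i) L.N" if "i \<in> {1..r}" for i
    using b[OF that] x'[OF that] by (simp only: A' I')
  from L.K2_rel_norm_ideal[OF assms(9) this] show ?thesis
    by (simp only: A' I' F)
qed

end
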